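(* For every integer $n\ge0$ and every set $P$ of $n$ points in general position in the plane, $\mathbb{R}^2\setminus P$ is the union of at most $\frac{7n}{11}+4$ convex subsets of $\mathbb{R}^2\setminus P$. That is, $cov(n)\le \frac{7n}{11}+4$.
   Context: A set of points in the plane is in general position if no three of its points are collinear. $cov(n)$ is the maximum, over all $n$-point sets $P$ in general position in the plane, of the smallest number of convex subsets of $\mathbb{R}^2\setminus P$ whose union is $\mathbb{R}^2\setminus P$. *)

theory Defs
  imports "HOL-Analysis.Analysis"
begin

definition in_general_position :: "(real^2) set \<Rightarrow> bool" where
  "in_general_position P \<longleftrightarrow>
     (\<forall>a\<in>P. \<forall>b\<in>P. \<forall>c\<in>P. a \<noteq> b \<and> a \<noteq> c \<and> b \<noteq> c \<longrightarrow> \<not> collinear {a, b, c})"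

definition convex_cover_avoiding :: "(real^2) set \<Rightarrow> (real^2) set set \<Rightarrow> bool" where
  "convex_cover_avoiding P \<F> \<longleftrightarrow>
     (\<forall>C\<in>\<F>. convex C \<and> C \<subseteq> UNIV - P) \<and> \<Union>\<F> = UNIV - P"

definition cov_number :: "(real^2) set \<Rightarrow> nat" where
  "cov_number P = (LEAST k. \<exists>\<F>. finite \<F> \<and> card \<F> = k \<and> convex_cover_avoiding P \<F>)"

text \<open>\<open>Max\<close> is meaningful only on a finite nonempty set, and \<open>LEAST\<close> only if some finite cover
  exists. Both conditions hold here: every finite \<open>P\<close> has a finite cover, the size of which can be
  bounded in terms of the number of points, and point sets in general position exist for every
  \<open>n\<close> (for instance on a parabola).\<close>

definition cov :: "nat \<Rightarrow> nat" where
  "cov n = Max {cov_number P | P. finite P \<and> card P = n \<and> in_general_position P}"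

end

theory Submission imports Defs begin

text \<open>By induction on the number of points it suffices to find, whenever there are at least 11
  points, a reduction that removes \<open>m\<close> of them at the cost of \<open>c\<close> convex sets with
  \<open>11 c \<le> 7 m\<close>. Let \<open>p\<close> be an extreme point and \<open>u 1, u 2, \<dots>\<close> the other points in angular
  order about \<open>p\<close>. If a point \<open>a\<close> lies inside a triangle of other points, the three rays from \<open>a\<close>
  to the vertices cut the plane into convex sectors that contain neither \<open>a\<close> nor the vertices;
  with suitable triangles this removes 4, 5, 7 or 8 points at the cost of 2, 3, 4 or 5 sets.
  Cutting along the line through \<open>p\<close> and \<open>u 7\<close> also removes 8 points at the cost of 5 sets if
  \<open>u 1, \<dots>, u 5\<close> or \<open>u 2, \<dots>, u 6\<close> are not in convex position: 4 sets suffice to avoid those five,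
  and one more avoids the sixth point. If none of these reductions applies, then \<open>u 1, \<dots>, u 6\<close> are in convex position, and the
  lines through \<open>u 1, u 2\<close>, through \<open>u 3, u 4\<close> and through \<open>u 5, u 6\<close> cut three regions off the
  half plane of the line \<open>p\<close>, \<open>u 7\<close>. These regions and two copies of the region in the middle again
  remove 8 points at the cost of 5 sets.\<close>

section \<open>Convex covers and orientations\<close>

text \<open>The obstacle lies on the cutting lines: all their points must be covered except the
  given ones, which must be avoided. A ray from \<open>a\<close> through one vertex is broken by it
  into two pieces, one for each adjacent sector. A line through two given points is broken into
  three pieces, and a convex set that misses both points meets only one of them. The region beyond
  the line takes one piece, so the near side has to take two; hence the two copies of the middle
  region. The dearest removals cost 5 sets for 8 points, and 5/8 < 7/11. The constant 4 makes the
  trivial bound n + 1 sufficient up to n = 8. Most triangles are chosen so that one sector has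
  exactly three points, because three points cost 3 sets instead of the trivial 4. The step needs 11
  points because the last triangle, besides \<open>p\<close> and its six neighbours in angular
  order, uses four further points.\<close>

definition coverable :: "(real^2) set \<Rightarrow> (real^2) set \<Rightarrow> nat \<Rightarrow> bool" where
  "coverable K Q k \<longleftrightarrow>
     (\<exists>\<F>. finite \<F> \<and> card \<F> \<le> k \<and> (\<forall>C\<in>\<F>. convex C \<and> C \<inter> Q = {}) \<and> K - Q \<subseteq> \<Union>\<F>)"

lemma coverable_convex: "convex K \<Longrightarrow> K \<inter> Q = {} \<Longrightarrow> coverable K Q 1"
  unfolding coverable_def by (rule exI[of _ "{K}"]) auto

lemma coverable_mono:
  assumes "coverable L Q j" "K - Q \<subseteq> L" "j \<le> k"
  shows "coverable K Q k"
proof -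
  obtain \<F> where "finite \<F>" "card \<F> \<le> j" "\<forall>C\<in>\<F>. convex C \<and> C \<inter> Q = {}" "L - Q \<subseteq> \<Union>\<F>"
    using assms(1) unfolding coverable_def by blast
  with assms(2,3) show ?thesis
    unfolding coverable_def by (intro exI[of _ \<F>]) auto
qed

lemma coverable_Un:
  assumes "coverable K Q j" "coverable L Q k"
  shows "coverable (K \<union> L) Q (j + k)"
proof -
  obtain \<F> where F: "finite \<F>" "card \<F> \<le> j" "\<forall>C\<in>\<F>. convex C \<and> C \<inter> Q = {}" "K - Q \<subseteq> \<Union>\<F>"
    using assms(1) unfolding coverable_def by blast
  obtain \<G> where G: "finite \<G>" "card \<G> \<le> k" "\<forall>C\<in>\<G>. convex C \<and> C \<inter> Q = {}" "L - Q \<subseteq> \<Union>\<G>"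
    using assms(2) unfolding coverable_def by blast
  have "card (\<F> \<union> \<G>) \<le> j + k"
    using card_Un_le[of \<F> \<G>] F(2) G(2) by linarith
  with F G show ?thesis
    unfolding coverable_def by (intro exI[of _ "\<F> \<union> \<G>"]) auto
qed

text \<open>Intersecting the members of a cover with \<open>K\<close> keeps them convex, so inside
  \<open>K\<close> only the points of \<open>Q\<close> in \<open>K\<close> matter. Cutting the plane
  thus gives independent smaller problems.\<close>

lemma coverable_restrict:
  assumes "convex K" "coverable UNIV (Q \<inter> K) k"
  shows "coverable K Q k"
proof -
  obtain \<F> where F: "finite \<F>" "card \<F> \<le> k" "\<forall>C\<in>\<F>. convex C \<and> C \<inter> (Q \<inter> K) = {}"
      "UNIV - (Q \<inter> K) \<subseteq> \<Union>\<F>"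
    using assms(2) unfolding coverable_def by blast
  let ?G = "(\<lambda>C. C \<inter> K) ` \<F>"
  have "finite ?G" "card ?G \<le> k"
    using F(1,2) card_image_le[of \<F> "\<lambda>C. C \<inter> K"] by auto
  moreover have "\<forall>C\<in>?G. convex C \<and> C \<inter> Q = {}"
    using F(3) assms(1) by (auto intro: convex_Int)
  moreover have "K - Q \<subseteq> \<Union>?G" using F(4) by auto
  ultimately show ?thesis unfolding coverable_def by blast
qed

section \<open>Orientation of triples as twice the signed area\<close>

definition orient :: "real^2 \<Rightarrow> real^2 \<Rightarrow> real^2 \<Rightarrow> real" where
  "orient a b c = (b$1 - a$1) * (c$2 - a$2) - (b$2 - a$2) * (c$1 - a$1)"

lemma orient_rotate: "orient a b c = orient b c a"
  by (simp add: orient_def algebra_simps)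

lemma orient_swap: "orient a c b = - orient a b c"
  by (simp add: orient_def algebra_simps)

lemma orient_same [simp]: "orient a a b = 0" "orient a b a = 0" "orient b a a = 0"
  by (simp_all add: orient_def)

lemma orient_affine:
  assumes "s + t = 1"
  shows "orient a b (s *\<^sub>R v + t *\<^sub>R w) = s * orient a b v + t * orient a b w"
proof -
  have t: "t = 1 - s" using assms by simp
  show ?thesis unfolding t by (simp add: orient_def algebra_simps)
qed

lemma orient_affine_middle:
  assumes "s + t = 1"
  shows "orient a (s *\<^sub>R v + t *\<^sub>R w) b = s * orient a v b + t * orient a w b"
  using orient_affine[OF assms, of b a v w] by (metis orient_rotate)

lemma collinear_if_orient_zero:
  assumes "orient a b c = 0"
  shows "collinear {a, b, c}"
proof (cases "a = b")
  case True
  then show ?thesis by (simp add: insert_commute)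
next
  case False
  define v where "v = b - a"
  define w where "w = c - a"
  have e: "v$1 * w$2 = v$2 * w$1"
    using assms by (simp add: orient_def v_def w_def)
  have v: "v$1 \<noteq> 0 \<or> v$2 \<noteq> 0"
    using False by (auto simp: vec_eq_iff forall_2 v_def)
  have "\<exists>t. w = t *\<^sub>R v"
  proof (cases "v$1 = 0")
    case True
    then have "v$2 \<noteq> 0" "w$1 = 0" using e v by auto
    then show ?thesis using True
      by (intro exI[of _ "w$2 / v$2"]) (auto simp: vec_eq_iff forall_2)
  next
    case False
    then show ?thesis using e
      by (intro exI[of _ "w$1 / v$1"]) (auto simp: vec_eq_iff forall_2 field_simps)
  qed
  then obtain t where "w = t *\<^sub>R v" by blast
  then have c: "c = a + t *\<^sub>R (b - a)" unfolding v_def w_def by (metis add_diff_cancel_left' add_diff_eq)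
  have "\<forall>x\<in>{a, b, c}. \<exists>s. x = a + s *\<^sub>R (b - a)"
    using c by (auto intro: exI[of _ 0] exI[of _ 1])
  then show ?thesis
    unfolding collinear_alt by blast
qed

lemma orient_nonzero:
  assumes "in_general_position Q" "a \<in> Q" "b \<in> Q" "c \<in> Q" "a \<noteq> b" "a \<noteq> c" "b \<noteq> c"
  shows "orient a b c \<noteq> 0"
  using assms collinear_if_orient_zero[of a b c] unfolding in_general_position_def by auto

text \<open>If \<open>p\<close>, \<open>u\<close>, \<open>v\<close> are not collinear,
  \<open>orient p z u\<close> and \<open>orient p z v\<close> are affine coordinates of
  \<open>z\<close>. This is how a point on a boundary line is later recognised as one of the given
  points.\<close>

lemma orient_unique:
  assumes "orient p u v \<noteq> 0" "orient p z u = orient p w u" "orient p z v = orient p w v"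
  shows "z = w"
proof -
  let ?e = "z$1 - w$1" and ?f = "z$2 - w$2"
  have 1: "?e * (u$2 - p$2) = ?f * (u$1 - p$1)" "?e * (v$2 - p$2) = ?f * (v$1 - p$1)"
    using assms(2,3) by (simp_all add: orient_def algebra_simps)
  have "orient p u v * ?e = 0" "orient p u v * ?f = 0"
    using 1 unfolding orient_def by algebra+
  then have "?e = 0" "?f = 0" using assms(1) by auto
  then show ?thesis by (simp add: vec_eq_iff forall_2)
qed

text \<open>With positive weights, one positive value of \<open>f\<close> makes the value at the
  combination positive, so the boundary matters only when both points lie on it. An open half-plane
  may therefore be enlarged by any convex piece of its boundary line; this is how boundary lines are
  shared out.\<close>

lemma convex_hemispace:
  assumes "convex {z. P z}"
    and "\<And>s t v w. s + t = 1 \<Longrightarrow> f (s *\<^sub>R v + t *\<^sub>R w) = s * f v + t * (f w :: real)"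
  shows "convex {z :: real^2. 0 < f z \<or> f z = 0 \<and> P z}"
  unfolding convex_def
proof (intro ballI allI impI)
  fix x y :: "real^2" and u v :: real
  assume x: "x \<in> {z. 0 < f z \<or> f z = 0 \<and> P z}" and y: "y \<in> {z. 0 < f z \<or> f z = 0 \<and> P z}"
    and u: "0 \<le> u" and v: "0 \<le> v" and uv: "u + v = 1"
  have f: "f (u *\<^sub>R x + v *\<^sub>R y) = u * f x + v * f y" by (rule assms(2)[OF uv])
  have P: "P (u *\<^sub>R x + v *\<^sub>R y)" if "P x" "P y"
    using assms(1) that u v uv unfolding convex_def by auto
  show "u *\<^sub>R x + v *\<^sub>R y \<in> {z. 0 < f z \<or> f z = 0 \<and> P z}"
  proof (cases "u = 0 \<or> v = 0")
    case True
    then show ?thesis using x y uv by auto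
  next
    case False
    then have uv0: "0 < u" "0 < v" using u v by auto
    have fx: "0 \<le> f x" "0 \<le> f y" using x y by auto
    consider "f x = 0 \<and> f y = 0" | "0 < u * f x + v * f y"
      using fx uv0 by (metis add_nonneg_pos add_pos_nonneg less_eq_real_def mult_pos_pos mult_zero_right)
    then show ?thesis
    proof cases
      case 1
      then show ?thesis using f P x y by auto
    next
      case 2
      then show ?thesis using f by simp
    qed
  qed
qed

lemma convex_Collect_conj:
  "convex {z. P z} \<Longrightarrow> convex {z. Q z} \<Longrightarrow> convex {z. P z \<and> Q z}"
  using convex_Int[of "{z. P z}" "{z. Q z}"] by (simp add: Collect_conj_eq)

lemma convex_affine_less:
  assumes "\<And>s t v w. s + t = 1 \<Longrightarrow> f (s *\<^sub>R v + t *\<^sub>R w) = s * f v + t * (f w :: real)"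
  shows "convex {z :: real^2. c < f z}" "convex {z :: real^2. f z < c}"
proof -
  have *: "s * (f v - c) + t * (f w - c) = f (s *\<^sub>R v + t *\<^sub>R w) - c" if "s + t = 1" for s t v w
  proof -
    have "s * c + t * c = c" using that by (metis distrib_right mult_1)
    then show ?thesis using assms[OF that, of v w] by (simp add: algebra_simps)
  qed
  have "convex {z. 0 < f z - c \<or> f z - c = 0 \<and> False}"
    by (rule convex_hemispace) (simp_all add: *)
  moreover have "convex {z. 0 < c - f z \<or> c - f z = 0 \<and> False}"
    by (rule convex_hemispace) (use * in \<open>simp_all add: algebra_simps\<close>)
  ultimately show "convex {z :: real^2. c < f z}" "convex {z :: real^2. f z < c}"
    by simp_all
qed

lemmas convex_orient =
  convex_affine_less[of "\<lambda>z. orient a b z" for a b, OF orient_affine]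
  convex_affine_less[of "\<lambda>z. orient a z b" for a b, OF orient_affine_middle]

lemma convex_hemispace_orient:
  assumes "convex {z. P z}"
  shows "convex {z. 0 < orient a b z \<or> orient a b z = 0 \<and> P z}"
    "convex {z. 0 < orient a z b \<or> orient a z b = 0 \<and> P z}"
  by (rule convex_hemispace[OF assms]; rule orient_affine orient_affine_middle; assumption)+

section \<open>Sectors at a point\<close>

lemma in_general_position_subset: "in_general_position Q \<Longrightarrow> P \<subseteq> Q \<Longrightarrow> in_general_position P"
  unfolding in_general_position_def by blast

text \<open>The three-term Pluecker relation for the vectors from \<open>a\<close> to the other four
  points.\<close>

lemma orient_plucker:
  "orient a x y * orient a z w - orient a x z * orient a y w + orient a x w * orient a y z = 0"
  by (simp add: orient_def algebra_simps)

lemma coverable_Un3: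
  assumes "coverable K1 Q k1" "coverable K2 Q k2" "coverable K3 Q k3"
    and "UNIV - Q \<subseteq> K1 \<union> K2 \<union> K3"
  shows "coverable UNIV Q (k1 + k2 + k3)"
  using coverable_mono[OF coverable_Un[OF coverable_Un[OF assms(1,2)] assms(3)] assms(4)] by simp

definition sector :: "real^2 \<Rightarrow> real^2 \<Rightarrow> real^2 \<Rightarrow> (real^2) set" where
  "sector a x y = {w. 0 < orient a x w \<and> 0 < orient a w y}"

text \<open>On the line through \<open>a\<close> and \<open>x\<close> (or \<open>y\<close>) the
  bounded value is \<open>t * orient a x y\<close>, where \<open>t\<close> is the position of
  \<open>w\<close> on it. So the first condition adds the open segment from \<open>a\<close> to
  \<open>x\<close> (0 < t < 1), the second the ray beyond \<open>y\<close> (t > 1). The adjacent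
  sectors receive the complementary pieces.\<close>

definition clopen_sector :: "real^2 \<Rightarrow> real^2 \<Rightarrow> real^2 \<Rightarrow> (real^2) set" where
  "clopen_sector a x y =
     {w. (0 < orient a x w \<or> orient a x w = 0 \<and> 0 < orient a w y \<and> orient a w y < orient a x y) \<and>
         (0 < orient a w y \<or> orient a w y = 0 \<and> orient a x y < orient a x w)}"

lemma convex_clopen_sector: "convex (clopen_sector a x y)"
  unfolding clopen_sector_def
  by (intro convex_Collect_conj convex_hemispace_orient convex_orient)

lemma clopen_sector_Int:
  assumes gp: "in_general_position Q" "a \<in> Q" "x \<in> Q" "y \<in> Q" and axy: "0 < orient a x y"
  shows "Q \<inter> clopen_sector a x y = Q \<inter> sector a x y"
proof -
  have d: "a \<noteq> x" "a \<noteq> y" "x \<noteq> y" using axy by auto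
  have "w \<in> clopen_sector a x y \<longleftrightarrow> w \<in> sector a x y" if "w \<in> Q" for w
  proof (cases "w = a \<or> w = x \<or> w = y")
    case True
    then show ?thesis using axy by (auto simp: clopen_sector_def sector_def)
  next
    case False
    then have "orient a x w \<noteq> 0" "orient a w y \<noteq> 0"
      using d that gp(2-4) orient_nonzero[OF gp(1), of a x w] orient_nonzero[OF gp(1), of a w y] by auto
    then show ?thesis by (auto simp: clopen_sector_def sector_def)
  qed
  then show ?thesis by blast
qed

text \<open>\<open>u\<close>, \<open>v\<close>, \<open>w\<close> are the orientations of a point
  with respect to the three rays, and \<open>sum\<close> is the Pluecker relation. As the weighted
  sum vanishes, nonzero signs are mixed, so cyclically some positive value is followed by a negative
  one, which names the open sector. The four exclusions say that the point is neither the centre nor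
  a vertex.\<close>

lemma sector_signs:
  fixes A B C u v w :: real
  assumes pos: "0 < A" "0 < B" "0 < C" and sum: "B * u + C * v + A * w = 0"
    and "\<not> (u = 0 \<and> v = 0)" "\<not> (u = 0 \<and> -v = A)" "\<not> (v = 0 \<and> -w = B)" "\<not> (w = 0 \<and> -u = C)"
  shows "(0 < u \<or> u = 0 \<and> 0 < -v \<and> -v < A) \<and> (0 < -v \<or> -v = 0 \<and> A < u) \<or>
         (0 < v \<or> v = 0 \<and> 0 < -w \<and> -w < B) \<and> (0 < -w \<or> -w = 0 \<and> B < v) \<or>
         (0 < w \<or> w = 0 \<and> 0 < -u \<and> -u < C) \<and> (0 < -u \<or> -u = 0 \<and> C < w)"
proof -
  have ray: "Y < s" if "Y * t + X * s = 0" "0 < X" "0 < Y" "X < -t" for X Y s t :: real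
  proof -
    have "X * s = Y * (-t)" using that(1) by simp
    also have "X * Y < Y * (-t)"
      using mult_strict_left_mono[OF that(4,3)] by (simp add: mult.commute)
    finally show ?thesis using that(2) by simp
  qed
  have sg: "(0 < s \<longleftrightarrow> t < 0) \<and> (s < 0 \<longleftrightarrow> 0 < t) \<and> (s = 0 \<longleftrightarrow> t = 0)"
    if "Y * t + X * s = 0" "0 < X" "0 < Y" for X Y s t :: real
  proof -
    define r where "r = Y / X"
    have "s = - (r * t)" "0 < r"
      using that by (simp_all add: field_simps r_def)
    then show ?thesis
      by (auto simp: zero_less_mult_iff mult_less_0_iff)
  qed
  have nn: "\<not> (0 < u \<and> 0 < v \<and> 0 < w)" "\<not> (u < 0 \<and> v < 0 \<and> w < 0)"
    using sum pos mult_pos_pos[of B u] mult_pos_pos[of C v] mult_pos_pos[of A w]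
      mult_pos_neg[of B u] mult_pos_neg[of C v] mult_pos_neg[of A w] by linarith+
  show ?thesis
  \<comment> \<open>If \<open>u = 0\<close>, the point is on the line of the first ray. Opposite to
    the ray it is in the second sector; on the ray, comparing \<open>-v\<close> with
    \<open>A\<close> tells the segment from the part beyond the vertex, and \<open>ray\<close>
    transfers this comparison to \<open>w\<close>. The other cases are cyclic shifts.\<close>
  proof (cases "u = 0")
    case True
    then have e: "C * v + A * w = 0" using sum by simp
    show ?thesis using True sg[OF e pos(1,3)] ray[OF e pos(1,3)] assms(5,6) by (smt (verit))
  next
    case u: False
    show ?thesis
    proof (cases "v = 0")
      case True
      then have e: "A * w + B * u = 0" using sum by simp
      show ?thesis using True u sg[OF e pos(2,1)] ray[OF e pos(2,1)] assms(7) by (smt (verit))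
    next
      case v: False
      show ?thesis
      proof (cases "w = 0")
        case True
        then have e: "B * u + C * v = 0" using sum by simp
        show ?thesis using True u v sg[OF e pos(3,2)] ray[OF e pos(3,2)] assms(8) by (smt (verit))
      next
        case False
        then show ?thesis using nn u v by linarith
      qed
    qed
  qed
qed

lemma clopen_sector_cover:
  assumes "0 < orient a x y" "0 < orient a y z" "0 < orient a z x" "w \<notin> {a, x, y, z}"
  shows "w \<in> clopen_sector a x y \<union> clopen_sector a y z \<union> clopen_sector a z x"
proof -
  have swap: "orient a w t = - orient a t w" for t by (rule orient_swap)
  have on_ray: "\<not> (orient a s w = 0 \<and> - orient a t w = orient a s t)"
    if "0 < orient a s t" "s \<in> {x, y, z}" for s t
    using orient_unique[of a s t w s] that assms(4) by (auto simp: swap)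
  have n: "\<not> (orient a x w = 0 \<and> orient a y w = 0)"
    using orient_unique[of a x y w a] assms by (auto simp: swap)
  have sum: "orient a y z * orient a x w + orient a z x * orient a y w + orient a x y * orient a z w = 0"
    using orient_plucker[of a x y z w] orient_swap[of a x z] by (simp add: algebra_simps)
  show ?thesis
    using sector_signs[OF assms(1,2,3) sum n on_ray[OF assms(1)] on_ray[OF assms(2)] on_ray[OF assms(3)]]
    unfolding clopen_sector_def by (simp add: swap[of x] swap[of y] swap[of z])
qed

lemma coverable_sectors:
  assumes gp: "in_general_position Q" and Q: "{a, x, y, z} \<subseteq> Q"
    and pos: "0 < orient a x y" "0 < orient a y z" "0 < orient a z x"
    and cov: "coverable UNIV (Q \<inter> sector a x y) i" "coverable UNIV (Q \<inter> sector a y z) j"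
      "coverable UNIV (Q \<inter> sector a z x) k"
  shows "coverable UNIV Q (i + j + k)"
proof (rule coverable_Un3)
  show "coverable (clopen_sector a x y) Q i" "coverable (clopen_sector a y z) Q j"
    "coverable (clopen_sector a z x) Q k"
    using gp Q pos cov
    by (simp_all add: coverable_restrict[OF convex_clopen_sector] clopen_sector_Int)
  show "UNIV - Q \<subseteq> clopen_sector a x y \<union> clopen_sector a y z \<union> clopen_sector a z x"
    using clopen_sector_cover[OF pos] Q by blast
qed

text \<open>The line through \<open>p\<close> and \<open>q\<close> cuts off the side of
  \<open>m\<close>, and the ray from \<open>p\<close> through \<open>m\<close> splits that side. On
  the line, \<open>K1\<close> takes the ray opposite to \<open>q\<close>, \<open>K3\<close> the open
  segment, \<open>K2\<close> the ray beyond \<open>q\<close>; on the ray, \<open>K1\<close> takes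
  the open segment and \<open>K2\<close> the part beyond \<open>m\<close>.\<close>

lemma coverable_fan:
  assumes gp: "in_general_position Q" and Q: "{p, m, q} \<subseteq> Q" and pmq: "0 < orient p m q"
    and cov: "coverable UNIV (Q \<inter> {w. 0 < orient p w q \<and> 0 < orient p w m}) i"
      "coverable UNIV (Q \<inter> sector p m q) j"
      "coverable UNIV (Q \<inter> {w. orient p w q < 0}) k"
  shows "coverable UNIV Q (i + j + k)"
proof (rule coverable_Un3)
  define K1 where "K1 = {w. (0 < orient p w q \<or> orient p w q = 0 \<and> 0 < orient p w m) \<and>
    (0 < orient p w m \<or> orient p w m = 0 \<and> 0 < orient p w q \<and> orient p w q < orient p m q)}"
  define K2 where "K2 = {w. (0 < orient p w q \<or> orient p w q = 0 \<and> orient p m q < orient p m w) \<and>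
    (0 < orient p m w \<or> orient p m w = 0 \<and> orient p m q < orient p w q)}"
  define K3 where "K3 = {w. 0 < orient p q w \<or> orient p q w = 0 \<and> 0 < orient p m w \<and> orient p m w < orient p m q}"
  have conv1: "convex K1"
    unfolding K1_def by (intro convex_Collect_conj convex_hemispace_orient convex_orient)
  have conv2: "convex K2"
    unfolding K2_def by (intro convex_Collect_conj convex_hemispace_orient convex_orient)
  have conv3: "convex K3"
    unfolding K3_def by (intro convex_Collect_conj convex_hemispace_orient convex_orient)
  have d: "p \<noteq> m" "p \<noteq> q" "m \<noteq> q" using pmq by auto
  have qw: "orient p q w = - orient p w q" and mw: "orient p m w = - orient p w m" for w
    by (rule orient_swap)+
  have Q0: "w = p \<or> w = m \<or> w = q \<or> (orient p w m \<noteq> 0 \<and> orient p w q \<noteq> 0)" if "w \<in> Q" for w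
    using that Q d orient_nonzero[OF gp, of p w m] orient_nonzero[OF gp, of p w q] by auto
  have "w \<in> K1 \<longleftrightarrow> 0 < orient p w q \<and> 0 < orient p w m"
    "w \<in> K2 \<longleftrightarrow> w \<in> sector p m q" "w \<in> K3 \<longleftrightarrow> orient p w q < 0" if wQ: "w \<in> Q" for w
  proof -
    have n: "orient p q m < 0" using pmq orient_swap[of p q m] by linarith
    show "w \<in> K1 \<longleftrightarrow> 0 < orient p w q \<and> 0 < orient p w m"
    proof (cases "w \<in> {p, m, q}")
      case True
      then show ?thesis using pmq n by (auto simp: K1_def)
    next
      case False
      then show ?thesis using Q0[OF wQ] by (simp add: K1_def)
    qed
    show "w \<in> K2 \<longleftrightarrow> w \<in> sector p m q"
    proof (cases "w \<in> {p, m, q}")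
      case True
      then show ?thesis using pmq n by (auto simp: K2_def sector_def)
    next
      case False
      then show ?thesis using Q0[OF wQ] mw[of w] by (auto simp: K2_def sector_def)
    qed
    show "w \<in> K3 \<longleftrightarrow> orient p w q < 0"
    proof (cases "w \<in> {p, m, q}")
      case True
      then show ?thesis using pmq n by (auto simp: K3_def)
    next
      case False
      then show ?thesis using Q0[OF wQ] qw[of w] by (simp add: K3_def)
    qed
  qed
  then have "Q \<inter> K1 = Q \<inter> {w. 0 < orient p w q \<and> 0 < orient p w m}"
    "Q \<inter> K2 = Q \<inter> sector p m q" "Q \<inter> K3 = Q \<inter> {w. orient p w q < 0}"
    by blast+
  then show "coverable K1 Q i" "coverable K2 Q j" "coverable K3 Q k"
    using cov conv1 conv2 conv3 by (simp_all add: coverable_restrict)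
  show "UNIV - Q \<subseteq> K1 \<union> K2 \<union> K3"
  proof
    fix w assume w: "w \<in> UNIV - Q"
    have "w \<notin> {p, q, m}" using w Q by auto
    then have "\<not> (orient p w q = 0 \<and> orient p w m = 0)" "\<not> (orient p w q = 0 \<and> orient p m w = orient p m q)"
      "\<not> (orient p w m = 0 \<and> orient p w q = orient p m q)"
      using orient_unique[of p m q w p] orient_unique[of p m q w q] orient_unique[of p m q w m] pmq
        orient_swap[of p w m] orient_swap[of p q m]
      by auto
    then show "w \<in> K1 \<union> K2 \<union> K3"
      unfolding K1_def K2_def K3_def Un_iff mem_Collect_eq mw[of w] qw[of w] using pmq by argo
  qed
qed

section \<open>Upper bounds and angular order\<close>

definition cov_bound :: "nat \<Rightarrow> nat \<Rightarrow> bool" where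
  "cov_bound n k \<longleftrightarrow>
     (\<forall>Q. finite Q \<and> card Q \<le> n \<and> in_general_position Q \<longrightarrow> coverable UNIV Q k)"

lemma cov_boundD:
  "cov_bound n k \<Longrightarrow> finite Q \<Longrightarrow> card Q \<le> n \<Longrightarrow> in_general_position Q \<Longrightarrow> coverable UNIV Q k"
  unfolding cov_bound_def by blast

lemma cov_bound_mono: "cov_bound n k \<Longrightarrow> m \<le> n \<Longrightarrow> k \<le> l \<Longrightarrow> cov_bound m l"
  unfolding cov_bound_def using coverable_mono[of UNIV _ k UNIV l] by fastforce

section \<open>An extreme point and the angular order about it\<close>

definition lex_less :: "real^2 \<Rightarrow> real^2 \<Rightarrow> bool" where
  "lex_less p z \<longleftrightarrow> p$1 < z$1 \<or> p$1 = z$1 \<and> p$2 < z$2"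

lemma ex_lex_least:
  assumes "finite Q" "Q \<noteq> {}"
  shows "\<exists>p\<in>Q. \<forall>z\<in>Q - {p}. lex_less p z"
  using assms
proof (induction Q rule: finite_ne_induct)
  case (singleton x)
  then show ?case by simp
next
  case (insert x F)
  then obtain p where p: "p \<in> F" "\<forall>z\<in>F - {p}. lex_less p z" by blast
  have "x \<noteq> p" using p insert by auto
  then have "lex_less p x \<or> lex_less x p"
    by (auto simp: lex_less_def vec_eq_iff forall_2)
  then show ?case
  proof
    assume "lex_less p x"
    then show ?thesis using p by (intro bexI[of _ p]) auto
  next
    assume xp: "lex_less x p"
    have "lex_less x z" if "z \<in> F" for z
    proof (cases "z = p")
      case False
      then have "lex_less p z" using p that by blast
      then show ?thesis using xp by (auto simp: lex_less_def)
    qed (use xp in simp)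
    then show ?thesis by (intro bexI[of _ x]) auto
  qed
qed

text \<open>Vectors from \<open>p\<close> to lexicographically larger points span less than a half
  turn, and within such a range the orientation compares angles.\<close>

lemma orient_trans_lex:
  assumes "lex_less p u" "lex_less p v" "lex_less p w" "0 < orient p u v" "0 < orient p v w"
  shows "0 < orient p u w"
proof -
  define U1 U2 V1 V2 W1 W2 where d: "U1 = u$1 - p$1" "U2 = u$2 - p$2" "V1 = v$1 - p$1"
    "V2 = v$2 - p$2" "W1 = w$1 - p$1" "W2 = w$2 - p$2"
  have l: "0 < U1 \<or> U1 = 0 \<and> 0 < U2" "0 < V1 \<or> V1 = 0 \<and> 0 < V2" "0 < W1 \<or> W1 = 0 \<and> 0 < W2"
    using assms(1-3) by (auto simp: lex_less_def d)
  have o: "0 < U1 * V2 - U2 * V1" "0 < V1 * W2 - V2 * W1"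
    using assms(4,5) by (simp_all add: orient_def d)
  have U1: "0 < U1"
  proof (rule ccontr)
    assume "\<not> 0 < U1"
    then have "U1 = 0" "0 < U2" using l by auto
    then have "U2 * V1 < 0" using o by simp
    then show False using l(2) \<open>0 < U2\<close> by (auto simp: mult_less_0_iff)
  qed
  have V1: "0 < V1"
  proof (rule ccontr)
    assume "\<not> 0 < V1"
    then have "V1 = 0" "0 < V2" using l by auto
    then have "V2 * W1 < 0" using o by simp
    then show False using l(3) \<open>0 < V2\<close> by (auto simp: mult_less_0_iff)
  qed
  have "0 < U1 * (V1 * W2 - V2 * W1)" using U1 o(2) by simp
  moreover have "0 \<le> W1 * (U1 * V2 - U2 * V1)" using l(3) o(1) by (intro mult_nonneg_nonneg) auto
  moreover have "V1 * (U1 * W2 - U2 * W1) = U1 * (V1 * W2 - V2 * W1) + W1 * (U1 * V2 - U2 * V1)"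
    by (simp add: algebra_simps)
  ultimately have "0 < V1 * (U1 * W2 - U2 * W1)" by linarith
  then have "0 < U1 * W2 - U2 * W1" using V1 by (simp add: zero_less_mult_iff)
  then show ?thesis by (simp add: orient_def d)
qed

lemma orient_trans_halfplane:
  assumes "0 < orient a y u" "0 < orient a y v" "0 < orient a y w" "0 < orient a u v" "0 < orient a v w"
  shows "0 < orient a u w"
proof -
  have "orient a y v * orient a u w = orient a y u * orient a v w + orient a y w * orient a u v"
    using orient_plucker[of a y u v w] by linarith
  then have "0 < orient a y v * orient a u w" using assms by (simp add: add_pos_pos)
  then show ?thesis using assms(2) by (simp add: zero_less_mult_iff)
qed

lemma ex_least_of_total:
  assumes "finite S" "S \<noteq> {}"
    and trans: "\<And>u v w. \<lbrakk>u \<in> S; v \<in> S; w \<in> S; r u v; r v w\<rbrakk> \<Longrightarrow> r u w"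
    and total: "\<And>u v. \<lbrakk>u \<in> S; v \<in> S; u \<noteq> v\<rbrakk> \<Longrightarrow> r u v \<or> r v u"
  shows "\<exists>m\<in>S. \<forall>z\<in>S - {m}. r m z"
  using assms
proof (induction S rule: finite_ne_induct)
  case (singleton x)
  then show ?case by simp
next
  case (insert x F)
  have "\<exists>m\<in>F. \<forall>z\<in>F - {m}. r m z"
  proof (rule insert.IH)
    show "r u w" if "u \<in> F" "v \<in> F" "w \<in> F" "r u v" "r v w" for u v w
      using insert.prems(1)[of u v w] that by simp
    show "r u v \<or> r v u" if "u \<in> F" "v \<in> F" "u \<noteq> v" for u v
      using insert.prems(2)[of u v] that by simp
  qed
  then obtain m where m: "m \<in> F" "\<forall>z\<in>F - {m}. r m z" by blast
  have "x \<noteq> m" using m(1) insert.hyps by blast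
  then have "r m x \<or> r x m" using insert.prems(2)[of m x] m(1) by simp
  then show ?case
  proof
    assume "r m x"
    then show ?thesis using m by (intro bexI[of _ m]) auto
  next
    assume xm: "r x m"
    have "r x z" if "z \<in> F" for z
      using m xm that insert.prems(1)[of x m z] by (cases "z = m") simp_all
    then show ?thesis by (intro bexI[of _ x]) simp_all
  qed
qed

text \<open>Least elements are peeled off \<open>j\<close> times. The result supplies triangle
  vertices with a prescribed number of points before them in angular order.\<close>

lemma ex_rank:
  assumes "finite S" "j < card S"
    and "\<And>u v w. \<lbrakk>u \<in> S; v \<in> S; w \<in> S; r u v; r v w\<rbrakk> \<Longrightarrow> r u w"
    and "\<And>u v. \<lbrakk>u \<in> S; v \<in> S; u \<noteq> v\<rbrakk> \<Longrightarrow> r u v \<or> r v u"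
    and "\<And>u v. r u v \<Longrightarrow> \<not> r v u"
  shows "\<exists>z\<in>S. card {w \<in> S. r w z} = j"
  using assms(1-4)
proof (induction j arbitrary: S)
  case 0
  have "\<exists>m\<in>S. \<forall>z\<in>S - {m}. r m z"
  proof (rule ex_least_of_total)
    show "S \<noteq> {}" using 0(2) by auto
  qed (fact 0)+
  then obtain m where m: "m \<in> S" "\<forall>z\<in>S - {m}. r m z" by blast
  then have "{w \<in> S. r w m} = {}" using assms(5) by blast
  then have "card {w \<in> S. r w m} = 0" by (metis card.empty)
  then show ?case using m(1) by blast
next
  case (Suc j)
  have "\<exists>m\<in>S. \<forall>z\<in>S - {m}. r m z"
  proof (rule ex_least_of_total)
    show "S \<noteq> {}" using Suc.prems(2) by auto
  qed (fact Suc.prems)+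
  then obtain m where m: "m \<in> S" "\<forall>z\<in>S - {m}. r m z" by blast
  have "\<exists>z\<in>S - {m}. card {w \<in> S - {m}. r w z} = j"
  proof (rule Suc.IH)
    show "finite (S - {m})" "j < card (S - {m})"
      using Suc.prems(1,2) m(1) by simp_all
    show "r u w" if "u \<in> S - {m}" "v \<in> S - {m}" "w \<in> S - {m}" "r u v" "r v w" for u v w
      using Suc.prems(3)[of u v w] that by simp
    show "r u v \<or> r v u" if "u \<in> S - {m}" "v \<in> S - {m}" "u \<noteq> v" for u v
      using Suc.prems(4)[of u v] that by simp
  qed
  then obtain z where z: "z \<in> S - {m}" "card {w \<in> S - {m}. r w z} = j" by blast
  have "{w \<in> S. r w z} = insert m {w \<in> S - {m}. r w z}" using m z by auto
  then have "card {w \<in> S. r w z} = Suc j" using z(2) Suc.prems(1) by simp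
  then show ?case using z by blast
qed

lemma cov_bound_0: "cov_bound 0 1"
  unfolding cov_bound_def using coverable_convex[of UNIV "{}"] by auto

text \<open>The points lexicographically below and above the least point \<open>p\<close> form two
  convex sets that miss only \<open>p\<close>. The lower one contains no point of \<open>Q\<close>,
  so it counts as one set; the upper one contains \<open>Q - {p}\<close>.\<close>

lemma cov_bound_Suc:
  assumes "cov_bound n k"
  shows "cov_bound (Suc n) (Suc k)"
  unfolding cov_bound_def
proof (intro allI impI, elim conjE)
  fix Q assume fin: "finite Q" and card: "card Q \<le> Suc n" and gp: "in_general_position Q"
  show "coverable UNIV Q (Suc k)"
  proof (cases "Q = {}")
    case True
    then show ?thesis by (intro coverable_mono[OF coverable_convex[of UNIV Q]]) simp_all
  next
    case False
    then obtain p where p: "p \<in> Q" "\<forall>z\<in>Q - {p}. lex_less p z"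
      using ex_lex_least fin by blast
    define u where "u = p + axis 2 1"
    define v where "v = p + axis 1 1"
    have uv: "orient p u z = p$1 - z$1" "orient p z u = z$1 - p$1" "orient p v z = z$2 - p$2" for z
      by (simp_all add: orient_def u_def v_def axis_def)
    define L where "L = {z. 0 < orient p u z \<or> orient p u z = 0 \<and> orient p v z < 0}"
    define R where "R = {z. 0 < orient p z u \<or> orient p z u = 0 \<and> 0 < orient p v z}"
    have convL: "convex L"
      unfolding L_def by (intro convex_hemispace_orient convex_orient)
    have convR: "convex R"
      unfolding R_def by (intro convex_hemispace_orient convex_orient)
    have "z = p \<or> z \<notin> L \<and> z \<in> R" if "z \<in> Q" for z
    proof (cases "z = p")
      case False
      then have "lex_less p z" using p that by simp
      then show ?thesis unfolding L_def R_def mem_Collect_eq uv lex_less_def by argo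
    qed simp
    moreover have "p \<notin> L" "p \<notin> R" by (simp_all add: L_def R_def)
    ultimately have "L \<inter> Q = {}" "Q \<inter> R = Q - {p}" by blast+
    moreover have "coverable UNIV (Q - {p}) k"
      using fin card p by (intro cov_boundD[OF assms] in_general_position_subset[OF gp]) (auto simp: card_Diff_singleton)
    ultimately have "coverable L Q 1" "coverable R Q k"
      using coverable_convex[OF convL] coverable_restrict[OF convR] by metis+
    then have LR: "coverable (L \<union> R) Q (1 + k)" by (rule coverable_Un)
    have "UNIV - Q \<subseteq> L \<union> R"
    proof
      fix z assume "z \<in> UNIV - Q"
      then have "z \<noteq> p" using p by auto
      then have "z$1 \<noteq> p$1 \<or> z$2 \<noteq> p$2" by (simp add: vec_eq_iff forall_2)
      then show "z \<in> L \<union> R" unfolding L_def R_def Un_iff mem_Collect_eq uv by argo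
    qed
    then show ?thesis by (rule coverable_mono[OF LR]) simp
  qed
qed

lemma cov_bound_trivial: "cov_bound n (Suc n)"
  by (induction n) (simp_all add: cov_bound_0[simplified] cov_bound_Suc)

section \<open>Reductions by sectors\<close>

lemma sector_disjoint:
  "w \<in> sector a x y \<Longrightarrow> w \<notin> sector a y z"
  using orient_swap[of a w y] by (auto simp: sector_def)

lemma card_sectors_le:
  assumes fin: "finite Q" and Q: "{a, x, y, z} \<subseteq> Q"
    and pos: "0 < orient a x y" "0 < orient a y z" "0 < orient a z x"
  shows "4 + card (Q \<inter> sector a x y) + card (Q \<inter> sector a y z) + card (Q \<inter> sector a z x) \<le> card Q"
proof -
  have d: "distinct [a, x, y, z]" using pos by auto
  have n: "orient a y x < 0" "orient a z y < 0" "orient a x z < 0"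
    using pos orient_swap[of a x y] orient_swap[of a y z] orient_swap[of a z x] by linarith+
  have dis: "sector a x y \<inter> sector a y z = {}" "sector a y z \<inter> sector a z x = {}"
    "sector a z x \<inter> sector a x y = {}"
    using sector_disjoint by blast+
  have out: "t \<notin> sector a x y \<and> t \<notin> sector a y z \<and> t \<notin> sector a z x" if "t \<in> {a, x, y, z}" for t
    using that n by (auto simp: sector_def)
  let ?A = "{a, x, y, z}" and ?B = "Q \<inter> sector a x y" and ?C = "Q \<inter> sector a y z"
    and ?D = "Q \<inter> sector a z x"
  have "card (?A \<union> ?B \<union> ?C \<union> ?D) = card ?A + card ?B + card ?C + card ?D"
  proof -
    have "card (?A \<union> ?B \<union> ?C \<union> ?D) = card (?A \<union> ?B \<union> ?C) + card ?D"
      by (rule card_Un_disjoint) (use fin dis out in blast)+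
    moreover have "card (?A \<union> ?B \<union> ?C) = card (?A \<union> ?B) + card ?C"
      by (rule card_Un_disjoint) (use fin dis out in blast)+
    moreover have "card (?A \<union> ?B) = card ?A + card ?B"
      by (rule card_Un_disjoint) (use fin dis out in blast)+
    ultimately show ?thesis by simp
  qed
  moreover have "card ?A = 4" using d by simp
  moreover have "card (?A \<union> ?B \<union> ?C \<union> ?D) \<le> card Q"
    using fin Q by (intro card_mono) blast+
  ultimately show ?thesis by linarith
qed

text \<open>The third vertex \<open>z\<close> of a triangle around \<open>a\<close> is taken so that exactly \<open>j\<close> of the
  candidates \<open>C\<close> lie in the sector from \<open>y\<close> to \<open>z\<close>.\<close>

lemma coverable_cone:
  assumes fin: "finite Q" and gp: "in_general_position Q" and Q: "{a, x, y} \<subseteq> Q"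
    and axy: "0 < orient a x y"
    and N: "card (Q \<inter> sector a x y) = n"
    and R: "card {w \<in> Q. 0 < orient a y w \<and> 0 < orient a x w} = r"
    and C: "j < card {w \<in> Q. orient a x w < 0 \<and> 0 < orient a y w}"
    and bounds: "cov_bound n i" "cov_bound (r + j) k" "cov_bound (card Q - (4 + n + r + j)) l"
  shows "coverable UNIV Q (i + k + l)"
proof -
  let ?R = "{w \<in> Q. 0 < orient a y w \<and> 0 < orient a x w}"
  let ?C = "{w \<in> Q. orient a x w < 0 \<and> 0 < orient a y w}"
  have aa: "a \<noteq> x" "a \<noteq> y" "x \<noteq> y" using axy by auto
  have "\<exists>z\<in>?C. card {w \<in> ?C. 0 < orient a w z} = j"
  proof (rule ex_rank)
    show "0 < orient a u w" if "u \<in> ?C" "v \<in> ?C" "w \<in> ?C" "0 < orient a u v" "0 < orient a v w" for u v w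
      using that by (intro orient_trans_halfplane[of a y u v w]) simp_all
    show "0 < orient a u v \<or> 0 < orient a v u" if "u \<in> ?C" "v \<in> ?C" "u \<noteq> v" for u v
    proof -
      have "orient a u v \<noteq> 0"
        using that Q by (intro orient_nonzero[OF gp]) auto
      then show ?thesis using orient_swap[of a u v] by linarith
    qed
    show "\<not> 0 < orient a v u" if "0 < orient a u v" for u v
      using that orient_swap[of a u v] by linarith
  qed (use fin C in simp_all)
  then obtain z where z: "z \<in> Q" "orient a x z < 0" "0 < orient a y z"
    and j: "card {w \<in> ?C. 0 < orient a w z} = j" by blast
  have azx: "0 < orient a z x" using z(2) orient_swap[of a x z] by linarith
  \<comment> \<open>Seen from \<open>a\<close>, the points of \<open>?R\<close> lie between
    \<open>y\<close> and the direction opposite to \<open>x\<close>, and the candidates come after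
    that direction. So the sector up to \<open>z\<close> contains all of \<open>?R\<close> and the
    \<open>j\<close> candidates before \<open>z\<close>.\<close>
  have "Q \<inter> sector a y z = ?R \<union> {w \<in> ?C. 0 < orient a w z}"
  proof -
    have "w \<in> sector a y z \<longleftrightarrow> 0 < orient a y w \<and> (0 < orient a x w \<or> orient a x w < 0 \<and> 0 < orient a w z)"
      if w: "w \<in> Q" for w
    proof (cases "w = a \<or> w = x \<or> orient a y w \<le> 0")
      case True
      then show ?thesis
        using axy orient_swap[of a x y] by (auto simp: sector_def)
    next
      case False
      have "orient a x w \<noteq> 0"
        using False w Q aa by (intro orient_nonzero[OF gp]) auto
      moreover have "0 < orient a w z" if "0 < orient a x w"
      proof -
        have "orient a x y * orient a w z = orient a x w * orient a y z - orient a x z * orient a y w"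
          using orient_plucker[of a x y w z] by linarith
        moreover have "0 < orient a x w * orient a y z" using that z by simp
        moreover have "orient a x z * orient a y w < 0" using z False by (simp add: mult_less_0_iff)
        ultimately have "0 < orient a x y * orient a w z" by linarith
        then show ?thesis using axy by (simp add: zero_less_mult_iff)
      qed
      ultimately show ?thesis using False by (auto simp: sector_def)
    qed
    then show ?thesis by blast
  qed
  moreover have "?R \<inter> {w \<in> ?C. 0 < orient a w z} = {}" by auto
  ultimately have yz: "card (Q \<inter> sector a y z) = r + j"
    using R j fin by (simp add: card_Un_disjoint)
  have zx: "card (Q \<inter> sector a z x) \<le> card Q - (4 + n + r + j)"
    using card_sectors_le[OF fin _ axy z(3) azx] Q z(1) N yz by simp
  have sub: "in_general_position (Q \<inter> S)" "finite (Q \<inter> S)" for S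
    using gp fin by (auto intro: in_general_position_subset)
  show ?thesis
    using Q z(1)
    by (intro coverable_sectors[OF gp _ axy z(3) azx] cov_boundD[OF bounds(1)] cov_boundD[OF bounds(2)]
        cov_boundD[OF bounds(3)] sub) (use N yz zx in simp_all)
qed

lemma coverable_fan_bound:
  assumes fin: "finite Q" and gp: "in_general_position Q" and Q: "{p, m, q} \<subseteq> Q" and pmq: "0 < orient p m q"
    and cov: "coverable UNIV (Q \<inter> {w. 0 < orient p w q \<and> 0 < orient p w m}) i"
      "coverable UNIV (Q \<inter> sector p m q) j"
    and n: "card {w \<in> Q. 0 < orient p w q} = n" and l: "cov_bound (card Q - (n + 2)) l"
  shows "coverable UNIV Q (i + j + l)"
proof (rule coverable_fan[OF gp Q pmq cov])
  have pq: "p \<noteq> q" using pmq by auto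
  have "card {w \<in> Q. orient p w q < 0} + card {w \<in> Q. 0 < orient p w q} + card {p, q}
    = card ({w \<in> Q. orient p w q < 0} \<union> {w \<in> Q. 0 < orient p w q} \<union> {p, q})"
    using fin by (subst card_Un_disjoint; (force)?)+
  also have "\<dots> \<le> card Q" using fin Q by (intro card_mono) auto
  finally have "card {w \<in> Q. orient p w q < 0} \<le> card Q - (n + 2)"
    using n pq by simp
  moreover have "Q \<inter> {w. orient p w q < 0} = {w \<in> Q. orient p w q < 0}" by blast
  ultimately show "coverable UNIV (Q \<inter> {w. orient p w q < 0}) l"
    using fin by (intro cov_boundD[OF l] in_general_position_subset[OF gp]) auto
qed

text \<open>Besides \<open>a\<close> and the triangle at most one point is left, so three sectors
  and one extra set suffice; the trivial bound would be 6.\<close>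

lemma coverable_five:
  assumes fin: "finite Q" and card: "card Q \<le> 5" and gp: "in_general_position Q"
    and Q: "{a, x, y, z} \<subseteq> Q"
    and pos: "0 < orient a x y" "0 < orient a y z" "0 < orient a z x"
  shows "coverable UNIV Q 4"
proof -
  let ?n1 = "card (Q \<inter> sector a x y)" and ?n2 = "card (Q \<inter> sector a y z)"
    and ?n3 = "card (Q \<inter> sector a z x)"
  have "coverable UNIV (Q \<inter> S) (Suc (card (Q \<inter> S)))" for S
    using gp fin by (intro cov_boundD[OF cov_bound_trivial]) (auto intro: in_general_position_subset)
  then have "coverable UNIV Q (Suc ?n1 + Suc ?n2 + Suc ?n3)"
    by (intro coverable_sectors[OF gp Q pos])
  moreover have "?n1 + ?n2 + ?n3 \<le> 1"
    using card_sectors_le[OF fin Q pos] card by linarith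
  ultimately show ?thesis by (auto intro: coverable_mono)
qed

section \<open>Six points in convex position\<close>

lemma orient_swap_left: "orient b a c = - orient a b c"
  by (simp add: orient_def algebra_simps)

text \<open>Pluecker relations for five points of the plane, arranged so that all coefficients are
  positive when \<open>a\<close>, \<open>b\<close>, \<open>c\<close>, \<open>d\<close> are in
  angular order about \<open>p\<close>.\<close>

lemma orient_quad:
  "orient p b c * orient a c d = orient p a c * orient b c d + orient p c d * orient a b c"
  "orient p b c * orient a b d = orient p b d * orient a b c + orient p a b * orient b c d"
  "orient p a c * orient a b d = orient p a b * orient a c d + orient p a d * orient a b c"
  "orient p b d * orient a c d = orient p c d * orient a b d + orient p a d * orient b c d"
  by (simp_all add: orient_def algebra_simps)

text \<open>The affine map \<open>orient a b\<close> evaluated at \<open>w\<close> in barycentric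
  coordinates with respect to \<open>p\<close>, \<open>x\<close>, \<open>y\<close>.\<close>

lemma orient_barycentric:
  "orient p x y * orient a b w =
     orient p w y * orient a b x - orient p w x * orient a b y + orient x y w * orient a b p"
  by (simp add: orient_def algebra_simps)

lemma orient_split: "orient x y w = orient p x y + orient p w x - orient p w y"
  by (simp add: orient_def algebra_simps)

lemma pos_mult_cancel:
  fixes c x y :: real
  assumes "0 < c" "c * x = y"
  shows "0 < y \<Longrightarrow> 0 < x" "y < 0 \<Longrightarrow> x < 0" "0 \<le> y \<Longrightarrow> 0 \<le> x"
  using assms by (auto simp: zero_less_mult_iff mult_less_0_iff zero_le_mult_iff)

text \<open>With positive coefficients, left turns add up along a chain. This lemma and the next
  carry a sign from one end of a convex chain to the other.\<close>

lemma orient_pos_chain: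
  assumes "0 < orient p b c" "0 < orient p a c" "0 < orient p c d"
    and "0 \<le> orient a b c" "0 < orient b c d"
  shows "0 < orient a c d"
proof (rule pos_mult_cancel(1)[OF assms(1) orient_quad(1)])
  show "0 < orient p a c * orient b c d + orient p c d * orient a b c"
    using assms by (intro add_pos_nonneg mult_pos_pos mult_nonneg_nonneg) simp_all
qed

lemma orient_pos_chain_left:
  assumes "0 < orient p b c" "0 < orient p b d" "0 < orient p a b"
    and "0 < orient a b c" "0 \<le> orient b c d"
  shows "0 < orient a b d"
proof (rule pos_mult_cancel(1)[OF assms(1) orient_quad(2)])
  show "0 < orient p b d * orient a b c + orient p a b * orient b c d"
    using assms by (intro add_pos_nonneg mult_pos_pos mult_nonneg_nonneg) simp_all
qed

lemma coverable_Un6: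
  assumes "convex K1" "convex K2" "convex K3" "convex K4" "convex K5" "convex K6"
    and "K1 \<inter> Q = {}" "K2 \<inter> Q = {}" "K3 \<inter> Q = {}" "K4 \<inter> Q = {}" "K5 \<inter> Q = {}"
    and "coverable UNIV (Q \<inter> K6) l" "UNIV - Q \<subseteq> K1 \<union> K2 \<union> K3 \<union> K4 \<union> K5 \<union> K6"
  shows "coverable UNIV Q (5 + l)"
proof -
  have "coverable (K1 \<union> K2 \<union> K3 \<union> K4 \<union> K5 \<union> K6) Q (1 + 1 + 1 + 1 + 1 + l)"
    using assms(1-5,7-11) coverable_restrict[OF assms(6,12)]
    by (intro coverable_Un coverable_convex)
  then show ?thesis by (rule coverable_mono) (use assms(13) in simp_all)
qed

text \<open>\<open>p\<close>, \<open>u 1\<close>, ..., \<open>u 6\<close> are the vertices of a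
  convex heptagon in counterclockwise order; of \<open>u 7\<close> only the angular position is
  known.\<close>

locale cap =
  fixes p :: "real^2" and u :: "nat \<Rightarrow> real^2"
  assumes ang: "\<And>i j. 1 \<le> i \<Longrightarrow> i < j \<Longrightarrow> j \<le> 7 \<Longrightarrow> 0 < orient p (u i) (u j)"
    and cap: "\<And>i j k. 1 \<le> i \<Longrightarrow> i < j \<Longrightarrow> j < k \<Longrightarrow> k \<le> 6 \<Longrightarrow> 0 < orient (u i) (u j) (u k)"
begin

lemma ang_signs:
  assumes "1 \<le> i" "i < j" "j \<le> 7"
  shows "0 < orient p (u i) (u j)" "\<not> orient p (u i) (u j) < 0" "orient p (u i) (u j) \<noteq> 0"
    "orient p (u j) (u i) < 0" "\<not> 0 < orient p (u j) (u i)" "orient p (u j) (u i) \<noteq> 0"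
  using ang[OF assms] orient_swap[of p "u i" "u j"] by simp_all

lemma orient_apex:
  "orient (u i) (u j) p = orient p (u i) (u j)"
  using orient_rotate[of p "u i" "u j"] by simp

lemma cap_signs:
  assumes "1 \<le> i" "i < j" "j < k" "k \<le> 6"
  shows "0 < orient (u i) (u j) (u k)" "0 < orient (u j) (u k) (u i)"
    "0 < orient (u k) (u i) (u j)" "orient (u j) (u i) (u k) < 0"
    "orient (u i) (u k) (u j) < 0" "orient (u k) (u j) (u i) < 0"
  using cap[OF assms] orient_rotate[of "u i" "u j" "u k"] orient_rotate[of "u j" "u k" "u i"]
    orient_swap[of "u i" "u j" "u k"] orient_rotate[of "u i" "u k" "u j"]
    orient_rotate[of "u k" "u j" "u i"] orient_rotate[of "u j" "u i" "u k"] by linarith+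

text \<open>The points of the line through \<open>p\<close> and \<open>u 7\<close> are divided as follows: \<open>before\<close> takes the open
  ray opposite to \<open>u 7\<close>, \<open>before'\<close> the open ray beyond \<open>u 7\<close>, and \<open>K6\<close> the open segment. On the line
  through \<open>u i\<close> and \<open>u (i + 1)\<close>, for \<open>i = 1, 3, 5\<close>, the set beyond the line takes the ray after
  \<open>u (i + 1)\<close>, \<open>K3\<close> the open segment, and \<open>K5\<close> the ray before \<open>u i\<close>. Both \<open>K3\<close> and \<open>K5\<close> lie on the
  near side of the lines; for \<open>K5\<close> the line through \<open>p\<close> and \<open>u 5\<close> replaces the third one.\<close>

definition "before w \<longleftrightarrow> 0 < orient p w (u 7) \<or> orient p w (u 7) = 0 \<and> 0 < orient p w (u 1)" for w
definition "before' w \<longleftrightarrow> 0 < orient p w (u 7) \<or>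
  orient p w (u 7) = 0 \<and> orient p (u 1) (u 7) < orient p (u 1) w" for w
definition "K1 = {w. (0 < orient (u 2) (u 1) w \<or> orient (u 2) (u 1) w = 0 \<and> orient p w (u 2) < 0) \<and> before w}"
definition "K2 = {w. (0 < orient (u 4) (u 3) w \<or> orient (u 4) (u 3) w = 0 \<and> orient p w (u 4) < 0) \<and> before' w}"
definition "below_mid i j w \<longleftrightarrow> 0 < orient (u i) (u j) w \<or>
  orient (u i) (u j) w = 0 \<and> orient p w (u i) < 0 \<and> 0 < orient p w (u j)" for i j w
definition "K3 = {w. below_mid 1 2 w \<and> below_mid 3 4 w \<and> below_mid 5 6 w \<and> before' w}"
definition "K4 = {w. below_mid 1 2 w \<and> below_mid 3 4 w \<and>
  (0 < orient (u 6) (u 5) w \<or> orient (u 6) (u 5) w = 0 \<and> orient p w (u 6) < 0) \<and> before' w}"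
definition "K5 = {w. (0 < orient (u 1) (u 2) w \<or> orient (u 1) (u 2) w = 0 \<and> 0 < orient p w (u 1)) \<and>
  (0 < orient (u 3) (u 4) w \<or> orient (u 3) (u 4) w = 0 \<and> 0 < orient p w (u 3)) \<and>
  0 < orient p w (u 5) \<and> before w}"
definition "K6 = {w. 0 < orient p (u 7) w \<or> orient p (u 7) w = 0 \<and>
  0 < orient p (u 1) w \<and> orient p (u 1) w < orient p (u 1) (u 7)}"

lemmas K_defs = K1_def K2_def K3_def K4_def K5_def below_mid_def before_def before'_def

lemma convex_K1: "convex K1"
  unfolding K_defs by (intro convex_Collect_conj convex_hemispace_orient convex_orient)
lemma convex_K2: "convex K2"
  unfolding K_defs by (intro convex_Collect_conj convex_hemispace_orient convex_orient)
lemma convex_K3: "convex K3"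
  unfolding K_defs by (intro convex_Collect_conj convex_hemispace_orient convex_orient)
lemma convex_K4: "convex K4"
  unfolding K_defs by (intro convex_Collect_conj convex_hemispace_orient convex_orient)
lemma convex_K5: "convex K5"
  unfolding K_defs by (intro convex_Collect_conj convex_hemispace_orient convex_orient)
lemma convex_K6: "convex K6"
  unfolding K6_def by (intro convex_Collect_conj convex_hemispace_orient convex_orient)

lemma K_avoid:
  assumes "w \<in> insert p (u ` {1..7}) \<or> orient p w (u 7) < 0"
  shows "w \<notin> K1 \<and> w \<notin> K2 \<and> w \<notin> K3 \<and> w \<notin> K4 \<and> w \<notin> K5"
proof -
  have "{1..7} = {1, 2, 3, 4, 5, 6, 7 :: nat}" by auto
  then have "u ` {1..7} = {u 1, u 2, u 3, u 4, u 5, u 6, u 7}" by simp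
  then consider "orient p w (u 7) < 0" | "w = p" | "w = u 1" | "w = u 2" | "w = u 3" | "w = u 4"
    | "w = u 5" | "w = u 6" | "w = u 7"
    using assms by auto
  then show ?thesis
  proof cases
    case 1
    then show ?thesis by (simp add: K_defs)
  qed (simp_all add: K_defs ang_signs cap_signs[THEN order_less_imp_not_less] cap_signs orient_apex
      cap_signs[THEN less_imp_neq] cap_signs[THEN less_imp_neq, symmetric])
qed

lemma K_cover:
  assumes w: "w \<notin> insert p (u ` {1..7})"
  shows "w \<in> K1 \<union> K2 \<union> K3 \<union> K4 \<union> K5 \<union> K6"
proof -
  \<comment> \<open>\<open>g i > 0\<close> means that \<open>w\<close> comes before
    \<open>u i\<close> about \<open>p\<close>; \<open>F\<close>, \<open>H\<close>, \<open>N\<close>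
    are positive on the side of \<open>p\<close> of the three cutting lines.\<close>
  define g where "g i = orient p w (u i)" for i
  define F where "F = orient (u 1) (u 2) w"
  define H where "H = orient (u 3) (u 4) w"
  define N where "N = orient (u 5) (u 6) w"
  have neg: "orient (u 2) (u 1) w = - F" "orient (u 4) (u 3) w = - H" "orient (u 6) (u 5) w = - N"
    "orient p (u i) w = - g i" for i
    unfolding F_def H_def N_def g_def by (rule orient_swap orient_swap_left)+
  have wu: "w \<noteq> u i" if "1 \<le> i" "i \<le> 7" for i using w that by auto
  have ends: "\<not> (orient (u i) (u j) w = 0 \<and> (g i = 0 \<or> g j = 0))" if "1 \<le> i" "i < j" "j \<le> 6" for i j
  proof
    assume a: "orient (u i) (u j) w = 0 \<and> (g i = 0 \<or> g j = 0)"
    have "orient (u i) (u j) w = orient p (u i) (u j) + g i - g j"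
      unfolding g_def by (rule orient_split)
    then have e: "g j = orient p (u i) (u j) + g i" using a by linarith
    have nz: "orient p (u i) (u j) \<noteq> 0" using ang_signs(3) that by simp
    have "w = u i" if "g i = 0"
      by (rule orient_unique[OF nz]) (use e that in \<open>simp_all add: g_def\<close>)
    moreover have "w = u j" if "g j = 0"
      by (rule orient_unique[OF nz])
        (use e that orient_swap[of p "u j" "u i"] in \<open>simp_all add: g_def\<close>)
    ultimately have "w = u i \<or> w = u j" using a by blast
    then show False using wu[of i] wu[of j] that by linarith
  qed
  \<comment> \<open>The hypotheses place \<open>w\<close> on the open segment from
    \<open>u i\<close> to \<open>u j\<close>, which stays on the side of a line that holds both
    ends.\<close>
  have mid: "0 < orient a b w"
    if "orient (u i) (u j) w = 0" "g i < 0" "0 < g j" "1 \<le> i" "i < j" "j \<le> 6"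
      "0 < orient a b (u i)" "0 < orient a b (u j)" for a b i j
  proof (rule pos_mult_cancel(1)[OF ang_signs(1) orient_barycentric])
    show "0 < orient p w (u j) * orient a b (u i) - orient p w (u i) * orient a b (u j) +
      orient (u i) (u j) w * orient a b p"
    proof -
      have "0 < orient p w (u j) * orient a b (u i)" "orient p w (u i) * orient a b (u j) < 0"
        using that by (simp_all add: g_def mult_neg_pos)
      then show ?thesis using that(1) by simp
    qed
  qed (use that in simp_all)
  have g_rel: "orient p (u i) (u 7) * g j = orient p (u i) (u j) * g 7 + orient p (u j) (u 7) * g i" for i j
    using orient_plucker[of p "u i" "u j" "u 7" w] neg(4) by (simp add: algebra_simps)
  have g_pos: "0 < g j" if "0 \<le> g 7" "0 < g i" "1 \<le> i" "i < j" "j \<le> 6" for i j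
  proof (rule pos_mult_cancel(1)[OF ang_signs(1) g_rel])
    show "0 < orient p (u i) (u j) * g 7 + orient p (u j) (u 7) * g i"
      using that ang_signs(1)[of i j] ang_signs(1)[of j 7] by (intro add_nonneg_pos mult_pos_pos mult_nonneg_nonneg) simp_all
  qed (use that in simp_all)
  have g_neg: "g j < 0" if "g 7 = 0" "g 1 < 0" "1 < j" "j \<le> 6" for j
  proof (rule pos_mult_cancel(2)[OF ang_signs(1) g_rel])
    show "orient p (u 1) (u j) * g 7 + orient p (u j) (u 7) * g 1 < 0"
      using that ang_signs(1)[of j 7] by (simp add: mult_pos_neg)
  qed simp_all
  \<comment> \<open>Here \<open>w\<close>, \<open>u 1\<close>, ..., \<open>u 4\<close> is again a
    convex chain. On the ray opposite to \<open>u 7\<close> only \<open>K1\<close> and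
    \<open>K5\<close> are available, and this fact ensures that one of them contains
    \<open>w\<close>.\<close>
  have left: "0 < H" if "0 \<le> g 7" "0 < g 1" "0 \<le> F"
  proof -
    have g: "0 < orient p w (u 1)" "0 < orient p w (u 2)" "0 < orient p w (u 3)"
      using that g_pos[of 1 2] g_pos[of 1 3] by (simp_all add: g_def)
    have "0 < orient w (u 2) (u 3)"
      using that(3) g
      by (intro orient_pos_chain[of p "u 1" "u 2" w "u 3"])
        (simp_all add: ang_signs cap_signs F_def orient_rotate[of w])
    then have "0 < orient w (u 3) (u 4)"
      using g by (intro orient_pos_chain[of p "u 2" "u 3" w "u 4"]) (simp_all add: ang_signs cap_signs)
    then show ?thesis by (simp add: H_def orient_rotate[of w])
  qed
  \<comment> \<open>The mirror image: on the ray beyond \<open>u 7\<close> only \<open>K2\<close>,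
    \<open>K3\<close> and \<open>K4\<close> are available, so a point on or beyond the first line
    must go to \<open>K2\<close>.\<close>
  have right: "H < 0" if "g 7 = 0" "g 1 < 0" "F \<le> 0"
  proof (rule ccontr)
    assume "\<not> H < 0"
    then have H: "0 \<le> orient (u 3) (u 4) w" by (simp add: H_def)
    have g: "0 < orient p (u 2) w" "0 < orient p (u 3) w" "0 < orient p (u 4) w"
      using that g_neg[of 2] g_neg[of 3] g_neg[of 4] neg(4)[of 2] neg(4)[of 3] neg(4)[of 4] by simp_all
    have "0 < orient (u 2) (u 3) w"
      using H g by (intro orient_pos_chain_left[of p "u 3" "u 4" w "u 2"]) (simp_all add: ang_signs cap_signs)
    then have "0 < orient (u 1) (u 2) w"
      using g by (intro orient_pos_chain_left[of p "u 2" "u 3" w "u 1"]) (simp_all add: ang_signs cap_signs)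
    then show False using that by (simp add: F_def)
  qed
  have b: "before w \<longleftrightarrow> 0 < g 7 \<or> g 7 = 0 \<and> 0 < g 1"
    "before' w \<longleftrightarrow> 0 < g 7 \<or> g 7 = 0 \<and> orient p (u 1) (u 7) < - g 1"
    by (simp_all add: before_def before'_def neg(4)) (simp_all add: g_def)
  have mem:
    "w \<in> K1 \<longleftrightarrow> (F < 0 \<or> F = 0 \<and> g 2 < 0) \<and> before w"
    "w \<in> K2 \<longleftrightarrow> (H < 0 \<or> H = 0 \<and> g 4 < 0) \<and> before' w"
    "w \<in> K3 \<longleftrightarrow> (0 < F \<or> F = 0 \<and> g 1 < 0 \<and> 0 < g 2) \<and> (0 < H \<or> H = 0 \<and> g 3 < 0 \<and> 0 < g 4) \<and>
      (0 < N \<or> N = 0 \<and> g 5 < 0 \<and> 0 < g 6) \<and> before' w"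
    "w \<in> K4 \<longleftrightarrow> (0 < F \<or> F = 0 \<and> g 1 < 0 \<and> 0 < g 2) \<and> (0 < H \<or> H = 0 \<and> g 3 < 0 \<and> 0 < g 4) \<and>
      (N < 0 \<or> N = 0 \<and> g 6 < 0) \<and> before' w"
    "w \<in> K5 \<longleftrightarrow> (0 < F \<or> F = 0 \<and> 0 < g 1) \<and> (0 < H \<or> H = 0 \<and> 0 < g 3) \<and> 0 < g 5 \<and> before w"
    "w \<in> K6 \<longleftrightarrow> g 7 < 0 \<or> g 7 = 0 \<and> g 1 < 0 \<and> - g 1 < orient p (u 1) (u 7)"
    unfolding K1_def K2_def K3_def K4_def K5_def K6_def below_mid_def mem_Collect_eq neg
    unfolding F_def[symmetric] H_def[symmetric] N_def[symmetric] g_def[symmetric] by simp_all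
  have c17: "0 < orient p (u 1) (u 7)" by (simp add: ang_signs)
  consider "w \<in> K6" | "before w" "before' w" "0 < g 7" | "before w" "g 7 = 0" "0 < g 1"
    | "before' w" "g 7 = 0" "g 1 < 0"
  proof -
    have nz: "orient p (u 1) (u 7) \<noteq> 0" using c17 by simp
    have "\<not> (g 7 = 0 \<and> g 1 = 0)"
      using orient_unique[OF nz, of w p] w by (auto simp: g_def)
    moreover have "\<not> (g 7 = 0 \<and> - g 1 = orient p (u 1) (u 7))"
    proof
      assume a: "g 7 = 0 \<and> - g 1 = orient p (u 1) (u 7)"
      have "orient p w (u 1) = orient p (u 7) (u 1)" "orient p w (u 7) = orient p (u 7) (u 7)"
        using a orient_swap[of p "u 1" "u 7"] orient_same(3)[of p "u 7"] unfolding g_def by linarith+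
      then have "w = u 7" by (rule orient_unique[OF nz])
      then show False using wu[of 7] by simp
    qed
    ultimately have "w \<in> K6 \<or> before w \<and> before' w \<and> 0 < g 7 \<or> before w \<and> g 7 = 0 \<and> 0 < g 1 \<or>
        before' w \<and> g 7 = 0 \<and> g 1 < 0"
      using c17 unfolding b mem by argo
    then show thesis using that by blast
  qed
  then show ?thesis
  proof cases
    case 1
    then show ?thesis by simp
  next
    case 2
    \<comment> \<open>The open segments of the cutting lines go to \<open>K3\<close>, provided that
      the later lines have them on their near side. The pieces before \<open>u 1\<close>,
      \<open>u 3\<close> and \<open>u 5\<close> go to \<open>K5\<close>; this works because all of
      them come before \<open>u 5\<close> about \<open>p\<close>.\<close>
    have m1: "0 < H \<and> 0 < N" if "F = 0" "g 1 < 0" "0 < g 2"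
      using mid[of 1 2 "u 3" "u 4"] mid[of 1 2 "u 5" "u 6"] that unfolding F_def H_def N_def
      by (simp add: cap_signs)
    have m3: "0 < N" if "H = 0" "g 3 < 0" "0 < g 4"
      using mid[of 3 4 "u 5" "u 6"] that unfolding H_def N_def by (simp add: cap_signs)
    show ?thesis
    proof -
      have e: "\<not> (F = 0 \<and> (g 1 = 0 \<or> g 2 = 0))" "\<not> (H = 0 \<and> (g 3 = 0 \<or> g 4 = 0))"
        "\<not> (N = 0 \<and> (g 5 = 0 \<or> g 6 = 0))"
        using ends[of 1 2] ends[of 3 4] ends[of 5 6] by (simp_all add: F_def H_def N_def)
      have l: "0 < g 1 \<longrightarrow> 0 < g 5" "0 < g 3 \<longrightarrow> 0 < g 5" "0 < g 1 \<longrightarrow> 0 \<le> F \<longrightarrow> 0 < H"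
        "0 < g 1 \<longrightarrow> 0 < g 2"
        using left g_pos[of 1 5] g_pos[of 3 5] g_pos[of 1 2] 2 by simp_all
      have m: "F = 0 \<longrightarrow> g 1 < 0 \<longrightarrow> 0 < g 2 \<longrightarrow> 0 < H \<and> 0 < N"
        "H = 0 \<longrightarrow> g 3 < 0 \<longrightarrow> 0 < g 4 \<longrightarrow> 0 < N"
        using m1 m3 by simp_all
      show ?thesis
        unfolding Un_iff mem using 2(1,2) e l m by argo
    qed
  next
    case 3
    then have "0 < g 2" "0 < g 3" "0 < g 4" "0 < g 5" "0 < g 6" "0 \<le> F \<longrightarrow> 0 < H"
      using g_pos[of 1] left by simp_all
    then show ?thesis unfolding Un_iff mem using 3(1,3) by argo
  next
    case 4
    then have "g 2 < 0" "g 3 < 0" "g 4 < 0" "g 5 < 0" "g 6 < 0" using g_neg by simp_all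
    moreover have "F \<le> 0 \<longrightarrow> H < 0" using right 4 by blast
    ultimately show ?thesis unfolding Un_iff mem using 4(1,3) by argo
  qed
qed

end

lemma coverable_cap:
  assumes "cap p u" and gp: "in_general_position Q" and fin: "finite Q"
    and Q: "insert p (u ` {1..7}) \<subseteq> Q"
    and rest: "\<And>w. w \<in> Q \<Longrightarrow> w \<notin> insert p (u ` {1..7}) \<Longrightarrow> orient p w (u 7) < 0"
    and l: "cov_bound (card Q - 8) l"
  shows "coverable UNIV Q (5 + l)"
proof -
  interpret cap p u by fact
  let ?U = "insert p (u ` {1..7})"
  have ne: "u i \<noteq> u j" if "1 \<le> i" "i < j" "j \<le> 7" for i j
    using ang_signs(3)[OF that] by auto
  have inj: "inj_on u {1..7}"
    by (rule linorder_inj_onI) (use ne in auto)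
  have p: "p \<noteq> u i" if "i \<in> {1..7}" for i
    using ang_signs(3)[of i 7] ang_signs(3)[of 1 7] that by (cases "i = 7") auto
  have U: "card ?U = 8"
  proof -
    have "p \<notin> u ` {1..7}" using p by blast
    moreover have "card (u ` {1..7}) = 7" using card_image[OF inj] by simp
    ultimately show ?thesis by (subst card_insert_disjoint) simp_all
  qed
  have out: "w \<notin> K6" if w: "w \<in> ?U" for w
  proof -
    have "{1..7} = {1, 2, 3, 4, 5, 6, 7 :: nat}" by auto
    then have "u ` {1..7} = {u 1, u 2, u 3, u 4, u 5, u 6, u 7}" by simp
    then consider "w = p" | "w = u 1" | "w = u 2" | "w = u 3" | "w = u 4" | "w = u 5" | "w = u 6" | "w = u 7"
      using w by auto
    then show ?thesis by cases (simp_all add: K6_def ang_signs)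
  qed
  have "card (Q \<inter> K6) \<le> card (Q - ?U)"
    using fin out by (intro card_mono) auto
  also have "\<dots> = card Q - 8"
    using U Q by (simp add: card_Diff_subset del: insert_subset)
  finally have "coverable UNIV (Q \<inter> K6) l"
    using fin by (intro cov_boundD[OF l] in_general_position_subset[OF gp]) auto
  moreover have "K1 \<inter> Q = {}" "K2 \<inter> Q = {}" "K3 \<inter> Q = {}" "K4 \<inter> Q = {}" "K5 \<inter> Q = {}"
    using K_avoid rest by blast+
  moreover have "UNIV - Q \<subseteq> K1 \<union> K2 \<union> K3 \<union> K4 \<union> K5 \<union> K6"
    using K_cover Q by blast
  ultimately show ?thesis
    by (intro coverable_Un6[OF convex_K1 convex_K2 convex_K3 convex_K4 convex_K5 convex_K6])
qed

section \<open>Points in angular order about an extreme point\<close>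

lemma ex_sorted_prefix:
  assumes fin: "finite S" and k: "k \<le> card S"
    and trans: "\<And>u v w. \<lbrakk>u \<in> S; v \<in> S; w \<in> S; r u v; r v w\<rbrakk> \<Longrightarrow> r u w"
    and total: "\<And>u v. \<lbrakk>u \<in> S; v \<in> S; u \<noteq> v\<rbrakk> \<Longrightarrow> r u v \<or> r v u"
  shows "\<exists>u :: nat \<Rightarrow> 'a. (\<forall>i\<in>{1..k}. u i \<in> S) \<and> (\<forall>i j. 1 \<le> i \<and> i < j \<and> j \<le> k \<longrightarrow> r (u i) (u j)) \<and>
    (\<forall>w\<in>S - u ` {1..k}. \<forall>i\<in>{1..k}. r (u i) w)"
  using k
proof (induction k)
  case 0
  then show ?case by simp
next
  case (Suc k)
  then have "k \<le> card S" by simp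
  from Suc.IH[OF this] obtain u where u: "\<forall>i\<in>{1..k}. u i \<in> S" "\<forall>i j. 1 \<le> i \<and> i < j \<and> j \<le> k \<longrightarrow> r (u i) (u j)"
    "\<forall>w\<in>S - u ` {1..k}. \<forall>i\<in>{1..k}. r (u i) w" by blast
  have "card (u ` {1..k}) < card S"
    using Suc.prems card_image_le[of "{1..k}" u] by simp
  then have "S - u ` {1..k} \<noteq> {}"
    using fin by (metis Diff_eq_empty_iff card_mono finite_atLeastAtMost finite_imageI leD)
  then have "\<exists>m\<in>S - u ` {1..k}. \<forall>z\<in>S - u ` {1..k} - {m}. r m z"
  proof (intro ex_least_of_total)
    show "finite (S - u ` {1..k})" using fin by simp
    show "r a c" if "a \<in> S - u ` {1..k}" "b \<in> S - u ` {1..k}" "c \<in> S - u ` {1..k}" "r a b" "r b c" for a b c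
      using trans[of a b c] that by simp
    show "r a b \<or> r b a" if "a \<in> S - u ` {1..k}" "b \<in> S - u ` {1..k}" "a \<noteq> b" for a b
      using total[of a b] that by simp
  qed
  then obtain m where m: "m \<in> S" "m \<notin> u ` {1..k}" "\<forall>z\<in>S - u ` {1..k} - {m}. r m z" by blast
  let ?v = "u(Suc k := m)"
  have im: "?v ` {1..Suc k} = insert m (u ` {1..k})"
  proof -
    have "?v ` {1..k} = u ` {1..k}" by (rule image_cong) simp_all
    moreover have "{1..Suc k} = insert (Suc k) {1..k}" by (rule atLeastAtMostSuc_conv) simp
    ultimately show ?thesis by (simp only: image_insert fun_upd_same)
  qed
  have 1: "?v i \<in> S" if "i \<in> {1..Suc k}" for i
  proof (cases "i = Suc k")
    case False
    then have "i \<in> {1..k}" using that by simp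
    then show ?thesis using u(1) False by simp
  qed (use m(1) in simp)
  have 2: "r (?v i) (?v j)" if ij: "1 \<le> i" "i < j" "j \<le> Suc k" for i j
  proof (cases "j = Suc k")
    case True
    then have "i \<in> {1..k}" "m \<in> S - u ` {1..k}" using ij m(1,2) by simp_all
    then have "r (u i) m" using u(3) by blast
    then show ?thesis using True ij by simp
  next
    case False
    then have "r (u i) (u j)" using u(2) ij by simp
    then show ?thesis using False ij by simp
  qed
  have 3: "r (?v i) w" if w: "w \<in> S - ?v ` {1..Suc k}" and i: "i \<in> {1..Suc k}" for w i
  proof -
    have w': "w \<in> S - u ` {1..k}" "w \<noteq> m" using w unfolding im by simp_all
    show ?thesis
    proof (cases "i = Suc k")
      case True
      then show ?thesis using m(3) w' by simp
    next
      case False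
      then have "i \<in> {1..k}" using i by simp
      then show ?thesis using u(3) w'(1) False by simp
    qed
  qed
  show ?case
    by (intro exI[of _ ?v] conjI ballI allI impI) (rule 1 2 3; (elim conjE)?; assumption)+
qed

lemma cov_bound_1: "cov_bound 1 2"
  using cov_bound_trivial[of 1] by (metis Suc_1)

lemma ex_apex:
  assumes fin: "finite Q" and gp: "in_general_position Q" and card: "k < card Q"
  shows "\<exists>p u. p \<in> Q \<and> (\<forall>i\<in>{1..k}. u i \<in> Q) \<and>
    (\<forall>i j. 1 \<le> i \<and> i < j \<and> j \<le> k \<longrightarrow> 0 < orient p (u i) (u j)) \<and>
    (\<forall>w\<in>Q - insert p (u ` {1..k}). \<forall>i\<in>{1..k}. 0 < orient p (u i) w)"
proof -
  obtain p where p: "p \<in> Q" "\<forall>z\<in>Q - {p}. lex_less p z"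
    using ex_lex_least[OF fin] card by fastforce
  have "\<exists>u :: nat \<Rightarrow> real^2. (\<forall>i\<in>{1..k}. u i \<in> Q - {p}) \<and>
    (\<forall>i j. 1 \<le> i \<and> i < j \<and> j \<le> k \<longrightarrow> 0 < orient p (u i) (u j)) \<and>
    (\<forall>w\<in>Q - {p} - u ` {1..k}. \<forall>i\<in>{1..k}. 0 < orient p (u i) w)"
  proof (rule ex_sorted_prefix)
    show "k \<le> card (Q - {p})" using card p(1) by simp
    show "0 < orient p u w" if "u \<in> Q - {p}" "v \<in> Q - {p}" "w \<in> Q - {p}" "0 < orient p u v" "0 < orient p v w"
      for u v w
      using that p(2) by (intro orient_trans_lex[of p u v w]) blast+
    show "0 < orient p u v \<or> 0 < orient p v u" if "u \<in> Q - {p}" "v \<in> Q - {p}" "u \<noteq> v" for u v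
    proof -
      have "orient p u v \<noteq> 0" using that p(1) by (intro orient_nonzero[OF gp]) blast+
      then show ?thesis using orient_swap[of p u v] by linarith
    qed
  qed (use fin in simp)
  then obtain u :: "nat \<Rightarrow> real^2" where u: "\<forall>i\<in>{1..k}. u i \<in> Q - {p}"
    "\<forall>i j. 1 \<le> i \<and> i < j \<and> j \<le> k \<longrightarrow> 0 < orient p (u i) (u j)"
    "\<forall>w\<in>Q - {p} - u ` {1..k}. \<forall>i\<in>{1..k}. 0 < orient p (u i) w" by blast
  have "Q - insert p (u ` {1..k}) = Q - {p} - u ` {1..k}" by blast
  then show ?thesis
    using u p(1) by (intro exI[of _ p] exI[of _ u]) simp
qed

text \<open>The line through the extreme point \<open>p\<close> and its second neighbour
  \<open>w\<close> cuts off only the first neighbour \<open>v\<close>, and the ray through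
  \<open>v\<close> splits that side into two pieces without points. The cost of 2 sets for 3 points
  exceeds 7/11, so this serves for small sets only.\<close>

lemma cov_bound_add3:
  assumes b: "cov_bound n k" and k: "0 < k"
  shows "cov_bound (n + 3) (k + 2)"
  unfolding cov_bound_def
proof (intro allI impI, elim conjE)
  fix Q assume fin: "finite Q" and card: "card Q \<le> n + 3" and gp: "in_general_position Q"
  show "coverable UNIV Q (k + 2)"
  proof (cases "card Q \<le> 2")
    case True
    then have "coverable UNIV Q (Suc 2)" using cov_boundD[OF cov_bound_trivial fin _ gp] by blast
    then show ?thesis by (rule coverable_mono) (use k in simp_all)
  next
    case False
    then obtain p and u :: "nat \<Rightarrow> real^2" where pu: "p \<in> Q" "\<forall>i\<in>{1..2}. u i \<in> Q"
      "\<forall>i j. 1 \<le> i \<and> i < j \<and> j \<le> 2 \<longrightarrow> 0 < orient p (u i) (u j)"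
      "\<forall>w\<in>Q - insert p (u ` {1..2}). \<forall>i\<in>{1..2}. 0 < orient p (u i) w"
    proof -
      have "2 < card Q" using False by simp
      from ex_apex[OF fin gp this] that show thesis by blast
    qed
    define v w where vw: "v = u 1" "w = u 2"
    have im: "u ` {1..2} = {v, w}" unfolding vw by (simp add: atLeastAtMostSuc_conv numeral_2_eq_2 insert_commute)
    have Q: "{p, v, w} \<subseteq> Q" using pu(1,2) by (simp add: vw)
    have vw_pos: "0 < orient p v w" using pu(3) by (simp add: vw)
    have after: "orient p z v < 0" "orient p z w < 0" if "z \<in> Q - {p, v, w}" for z
    proof -
      have "0 < orient p v z" "0 < orient p w z" using pu(4) that unfolding im vw by simp_all
      then show "orient p z v < 0" "orient p z w < 0"
        using orient_swap[of p z v] orient_swap[of p z w] by linarith+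
    qed
    have n: "orient p w v < 0" using vw_pos orient_swap[of p v w] by linarith
    have c: "z = p \<or> z = v \<or> z = w \<or> z \<in> Q - {p, v, w}" if "z \<in> Q" for z using that by blast
    have s: "0 < orient p z w \<longleftrightarrow> z = v" "\<not> 0 < orient p z v" if "z \<in> Q" for z
      using c[OF that] after[of z] vw_pos n by auto
    have e: "Q \<inter> {z. 0 < orient p z w \<and> 0 < orient p z v} = {}" "Q \<inter> sector p v w = {}"
      "{z \<in> Q. 0 < orient p z w} = {v}"
      using s Q by (auto simp: sector_def)
    have "coverable UNIV Q (1 + 1 + k)"
    proof (rule coverable_fan_bound[OF fin gp Q vw_pos])
      show "coverable UNIV (Q \<inter> {z. 0 < orient p z w \<and> 0 < orient p z v}) 1"
        "coverable UNIV (Q \<inter> sector p v w) 1"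
        unfolding e by (rule coverable_convex; simp)+
      show "card {z \<in> Q. 0 < orient p z w} = 1" unfolding e by simp
      show "cov_bound (card Q - (1 + 2)) k"
        by (rule cov_bound_mono[OF b]) (use card in simp_all)
    qed
    then show ?thesis by (simp add: numeral_2_eq_2)
  qed
qed

lemma cov_bound_3: "cov_bound 3 3"
  using cov_bound_add3[OF cov_bound_0] by (simp add: numeral_3_eq_3)

\<comment> \<open>keeps \<open>u 1\<close> from being rewritten to \<open>u (Suc 0)\<close>\<close>
declare One_nat_def [simp del]

text \<open>Only six neighbours are named. The later points form \<open>V\<close>, from which the
  seventh is chosen where it is needed.\<close>

locale fan_order =
  fixes Q :: "(real^2) set" and p :: "real^2" and u :: "nat \<Rightarrow> real^2"
  assumes fin: "finite Q" and gp: "in_general_position Q" and pQ: "p \<in> Q"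
    and uQ: "\<And>i. 1 \<le> i \<Longrightarrow> i \<le> 6 \<Longrightarrow> u i \<in> Q"
    and ang: "\<And>i j. 1 \<le> i \<Longrightarrow> i < j \<Longrightarrow> j \<le> 6 \<Longrightarrow> 0 < orient p (u i) (u j)"
    and rest: "\<And>w i. w \<in> Q \<Longrightarrow> w \<notin> insert p (u ` {1..6}) \<Longrightarrow> 1 \<le> i \<Longrightarrow> i \<le> 6 \<Longrightarrow> 0 < orient p (u i) w"
begin

definition "V = Q - insert p (u ` {1..6})"

lemma u_image: "u ` {1..6} = {u 1, u 2, u 3, u 4, u 5, u 6}"
proof -
  have "{1..6} = {1, 2, 3, 4, 5, 6 :: nat}" by auto
  then show ?thesis by simp
qed

lemma V_ang:
  assumes "w \<in> V" "1 \<le> i" "i \<le> 6"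
  shows "0 < orient p (u i) w"
  using rest[of w i] assms by (simp add: V_def)

lemma V_Q: "w \<in> V \<Longrightarrow> w \<in> Q"
  by (simp add: V_def)

lemma u_neq:
  assumes "1 \<le> i" "i < j" "j \<le> 6"
  shows "u i \<noteq> u j" "u j \<noteq> u i"
  using ang[OF assms] by auto

lemma p_neq:
  assumes "1 \<le> i" "i \<le> 6"
  shows "p \<noteq> u i" "u i \<noteq> p"
proof -
  have "0 < orient p (u 1) (u 6)" by (rule ang) simp_all
  moreover have "i = 6 \<or> 0 < orient p (u i) (u 6)" using ang[of i 6] assms by linarith
  ultimately show "p \<noteq> u i" "u i \<noteq> p" by auto
qed

lemma V_neq: "w \<in> V \<Longrightarrow> w \<noteq> p" "w \<in> V \<Longrightarrow> 1 \<le> i \<Longrightarrow> i \<le> 6 \<Longrightarrow> w \<noteq> u i"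
  unfolding V_def by auto

lemma card_V: "card Q = card V + 7"
proof -
  have "inj_on u {1..6}"
    by (rule linorder_inj_onI) (use u_neq in auto)
  then have "card (u ` {1..6}) = 6" using card_image by force
  moreover have "p \<notin> u ` {1..6}"
  proof
    assume "p \<in> u ` {1..6}"
    then obtain i where "p = u i" "1 \<le> i" "i \<le> 6" by auto
    then show False using p_neq(1) by blast
  qed
  ultimately have "card (insert p (u ` {1..6})) = 7"
    by (subst card_insert_disjoint) simp_all
  moreover have sub: "insert p (u ` {1..6}) \<subseteq> Q" using pQ uQ by auto
  moreover have "card V = card Q - card (insert p (u ` {1..6}))"
    unfolding V_def by (rule card_Diff_subset[OF _ sub]) simp
  moreover have "card (insert p (u ` {1..6})) \<le> card Q"
    by (rule card_mono[OF fin sub])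
  ultimately show ?thesis by linarith
qed

text \<open>These rules rewrite every orientation to one whose points occur in angular order about
  \<open>p\<close>, with \<open>p\<close> first.\<close>

lemma sort_u:
  assumes "i < j" "j < k"
  shows "orient (u i) (u k) (u j) = - orient (u i) (u j) (u k)"
    "orient (u j) (u i) (u k) = - orient (u i) (u j) (u k)"
    "orient (u j) (u k) (u i) = orient (u i) (u j) (u k)"
    "orient (u k) (u i) (u j) = orient (u i) (u j) (u k)"
    "orient (u k) (u j) (u i) = - orient (u i) (u j) (u k)"
  by (simp_all add: orient_def algebra_simps)

lemma sort_p:
  "orient (u i) (u j) p = orient p (u i) (u j)" "orient (u i) p (u j) = - orient p (u i) (u j)"
  by (simp_all add: orient_def algebra_simps)

lemma sort_p2: "i < j \<Longrightarrow> orient p (u j) (u i) = - orient p (u i) (u j)"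
  by (rule orient_swap)

lemma nonzero:
  assumes "1 \<le> i" "i < j" "j < k" "k \<le> 6"
  shows "orient (u i) (u j) (u k) \<noteq> 0"
  using assms u_neq(1)[of i j] u_neq(1)[of i k] u_neq(1)[of j k]
  by (intro orient_nonzero[OF gp] uQ) simp_all

lemma nonzero_V:
  assumes "w \<in> V" "1 \<le> i" "i < j" "j \<le> 6"
  shows "orient (u i) (u j) w \<noteq> 0"
  using assms u_neq(1)[of i j] V_neq(2)[of w i] V_neq(2)[of w j] V_Q[of w]
  by (intro orient_nonzero[OF gp] uQ) (simp_all add: eq_commute[of _ w])

text \<open>The triangle \<open>p\<close>, \<open>u 1\<close>, \<open>z\<close> contains \<open>u i\<close>, and its sector at \<open>u i\<close> between \<open>p\<close> and \<open>u 1\<close>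
  is empty.\<close>

lemma base_reduction:
  assumes i: "2 \<le> i" "i \<le> 5" and above: "\<And>j. 1 < j \<Longrightarrow> j < i \<Longrightarrow> 0 < orient (u 1) (u j) (u i)"
    and C: "j < card {w \<in> Q. 0 < orient p (u i) w \<and> orient (u 1) (u i) w < 0}"
    and k: "cov_bound (i - 2 + j) k" and l: "cov_bound (card Q - (2 + i + j)) l"
  shows "coverable UNIV Q (1 + k + l)"
proof -
  have inv: "orient (u i) p w = - orient p (u i) w" "orient (u i) (u 1) w = - orient (u 1) (u i) w"
    "orient (u i) w (u 1) = orient (u 1) (u i) w" for w
    by (simp_all add: orient_def algebra_simps)
  have pos: "0 < orient (u i) p (u 1)"
    using ang[of 1 i] i orient_rotate[of "u i" p "u 1"] by simp
  have before: "w \<in> u ` {1..<i}" if w: "w \<in> Q" "orient p (u i) w < 0" for w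
  proof -
    have "w \<noteq> p" using w(2) by auto
    moreover have "w \<notin> V" using w(2) V_ang[of w i] i by force
    ultimately obtain j where j: "w = u j" "1 \<le> j" "j \<le> 6" using w(1) unfolding V_def by auto
    have "\<not> i < j" using ang[of i j] w(2) j i by auto
    moreover have "i \<noteq> j" using w(2) j by auto
    ultimately show ?thesis using j by auto
  qed
  have low: "orient (u 1) (u i) w \<le> 0" if w: "w \<in> u ` {1..<i}" for w
  proof -
    obtain j where j: "w = u j" "1 \<le> j" "j < i" using w by auto
    show ?thesis
    proof (cases "j = 1")
      case False
      then show ?thesis using above[of j] j sort_u(1)[of 1 j i] by simp
    qed (use j in simp)
  qed
  \<comment> \<open>Only points before \<open>u i\<close> could lie in this sector, and
    \<open>above\<close> puts them on or beyond the line through \<open>u 1\<close> and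
    \<open>u i\<close>, seen from \<open>p\<close>.\<close>
  have N: "Q \<inter> sector (u i) p (u 1) = {}"
  proof -
    have "\<not> (0 < - orient p (u i) w \<and> 0 < orient (u 1) (u i) w)" if "w \<in> Q" for w
      using before[OF that] low[of w] by linarith
    then show ?thesis unfolding sector_def inv by blast
  qed
  have R: "{w \<in> Q. 0 < orient (u i) (u 1) w \<and> 0 < orient (u i) p w} = u ` {2..<i}"
  proof -
    have "w \<in> u ` {2..<i}" if w: "w \<in> Q" "0 < orient (u i) (u 1) w" "0 < orient (u i) p w" for w
    proof -
      have "w \<in> u ` {1..<i}" using before[OF w(1)] w(3) by (simp add: inv)
      then obtain j where j: "w = u j" "1 \<le> j" "j < i" by auto
      then have "j \<noteq> 1" using w(2) by auto
      then show ?thesis using j by simp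
    qed
    moreover have "w \<in> Q \<and> 0 < orient (u i) (u 1) w \<and> 0 < orient (u i) p w" if w: "w \<in> u ` {2..<i}" for w
    proof -
      obtain j where j: "w = u j" "2 \<le> j" "j < i" using w by auto
      then show ?thesis
        using above[of j] ang[of j i] sort_u(1)[of 1 j i] sort_p2[of j i] uQ[of j] i by (simp add: inv)
    qed
    ultimately show ?thesis by blast
  qed
  have "inj_on u {2..<i}"
    by (rule linorder_inj_onI) (use u_neq i in auto)
  then have r: "card {w \<in> Q. 0 < orient (u i) (u 1) w \<and> 0 < orient (u i) p w} = i - 2"
    unfolding R by (simp add: card_image)
  have C': "j < card {w \<in> Q. orient (u i) p w < 0 \<and> 0 < orient (u i) (u 1) w}"
    using C by (simp add: inv)
  have n: "card (Q \<inter> sector (u i) p (u 1)) = 0" unfolding N by simp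
  have "{u i, p, u 1} \<subseteq> Q" using uQ pQ i by simp
  \<comment> \<open>Removed are \<open>u i\<close>, \<open>p\<close>, \<open>u 1\<close>, the third
    vertex, the \<open>i - 2\<close> points between \<open>u 1\<close> and \<open>u i\<close>, and
    \<open>j\<close> more.\<close>
  moreover have "4 + 0 + (i - 2) + j = 2 + i + j" using i by linarith
  then have "cov_bound (card Q - (4 + 0 + (i - 2) + j)) l" using l by (simp only:)
  ultimately show ?thesis
    by (intro coverable_cone[OF fin gp _ pos n r C' cov_bound_0 k])
qed

end

section \<open>A counterexample to the induction step\<close>

lemma sign_of_sum:
  fixes c x y z :: real
  assumes "c * x = a * y + b * z" "0 < c" "0 < a" "0 < b"
  shows "0 < y \<and> 0 < z \<longrightarrow> 0 < x" "y < 0 \<and> z < 0 \<longrightarrow> x < 0"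
proof -
  have "0 < c * x" if "0 < y" "0 < z" unfolding assms(1) using that assms by (simp add: add_pos_pos)
  then show "0 < y \<and> 0 < z \<longrightarrow> 0 < x" using assms(2) by (simp add: zero_less_mult_iff)
  have "c * x < 0" if "y < 0" "z < 0"
    unfolding assms(1) using that assms by (simp add: add_neg_neg mult_pos_neg)
  then show "y < 0 \<and> z < 0 \<longrightarrow> x < 0" using assms(2) by (simp add: mult_less_0_iff)
qed

text \<open>The signotope condition: along the triples in lexicographic order \<open>A\<close>,
  \<open>B\<close>, \<open>C\<close>, \<open>D\<close> the sign changes at most once. Each relation
  of \<open>orient_quad\<close> makes a middle value a positive combination of an earlier and a
  later one.\<close>

lemma quad_signs:
  assumes "0 < orient p a b" "0 < orient p a c" "0 < orient p a d" "0 < orient p b c"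
    "0 < orient p b d" "0 < orient p c d"
    and "orient a b c \<noteq> 0" "orient a b d \<noteq> 0" "orient a c d \<noteq> 0" "orient b c d \<noteq> 0"
  defines "A \<equiv> 0 < orient a b c" and "B \<equiv> 0 < orient a b d" and "C \<equiv> 0 < orient a c d"
    and "D \<equiv> 0 < orient b c d"
  shows "(A \<and> D \<longrightarrow> B \<and> C) \<and> (\<not> A \<and> \<not> D \<longrightarrow> \<not> B \<and> \<not> C) \<and> (A \<and> C \<longrightarrow> B) \<and> (\<not> A \<and> \<not> C \<longrightarrow> \<not> B) \<and>
    (B \<and> D \<longrightarrow> C) \<and> (\<not> B \<and> \<not> D \<longrightarrow> \<not> C)"
proof -
  have neg: "orient a b c < 0 \<longleftrightarrow> \<not> A" "orient a b d < 0 \<longleftrightarrow> \<not> B" "orient a c d < 0 \<longleftrightarrow> \<not> C"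
    "orient b c d < 0 \<longleftrightarrow> \<not> D"
    using assms(7-10) unfolding A_def B_def C_def D_def by linarith+
  show ?thesis
    using sign_of_sum[OF orient_quad(1)[of p b c a d] assms(4,2,6)]
      sign_of_sum[OF orient_quad(2)[of p b c a d] assms(4,5,1)]
      sign_of_sum[OF orient_quad(3)[of p a c b d] assms(2,1,3)]
      sign_of_sum[OF orient_quad(4)[of p b d a c] assms(5,6,3)]
    unfolding neg A_def[symmetric] B_def[symmetric] C_def[symmetric] D_def[symmetric] by blast
qed

text \<open>The bound 7n/11 + 4 rounded down, so that the induction runs in the natural
  numbers.\<close>

definition target :: "nat \<Rightarrow> nat" where
  "target n = (7 * n + 44) div 11"

locale counterexample = fan_order +
  assumes card: "11 \<le> card Q"
    and IH: "\<And>m. m < card Q \<Longrightarrow> cov_bound m (target m)"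
    and bad: "\<not> coverable UNIV Q (target (card Q))"
begin

lemma no_reduction:
  assumes "1 \<le> m" "m \<le> card Q" "11 * c \<le> 7 * m" "coverable UNIV Q (c + target (card Q - m))"
  shows False
proof -
  have "c + target (card Q - m) = (11 * c + (7 * (card Q - m) + 44)) div 11"
    unfolding target_def by simp
  also have "\<dots> \<le> target (card Q)"
    unfolding target_def using assms by (intro div_le_mono) linarith
  finally show False using bad coverable_mono[OF assms(4)] by blast
qed

lemma IH_diff: "1 \<le> m \<Longrightarrow> cov_bound (card Q - m) (target (card Q - m))"
  using card by (intro IH) linarith

text \<open>Counted are the points \<open>w\<close> for which \<open>u i\<close> lies inside the
  triangle \<open>p\<close>, \<open>u 1\<close>, \<open>w\<close>. More than \<open>j\<close> of
  them would offer a third vertex with exactly \<open>j\<close> of them before it about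
  \<open>u i\<close>.\<close>

lemma card_neg_le:
  assumes "2 \<le> i" "i \<le> 5" "\<And>j. 1 < j \<Longrightarrow> j < i \<Longrightarrow> 0 < orient (u 1) (u j) (u i)"
    and "cov_bound (i - 2 + j) k" "11 * (1 + k) \<le> 7 * (2 + i + j)" "j \<le> 4"
  shows "card {w \<in> Q. 0 < orient p (u i) w \<and> orient (u 1) (u i) w < 0} \<le> j"
proof (rule ccontr)
  assume "\<not> ?thesis"
  then have "coverable UNIV Q (1 + k + target (card Q - (2 + i + j)))"
    by (intro base_reduction[OF assms(1-3) _ assms(4) IH_diff]) simp_all
  then show False
    by (rule no_reduction[rotated 3]) (use assms card in simp_all)
qed

lemma pos_if_no_neg:
  assumes "card {w \<in> Q. 0 < orient p (u i) w \<and> orient (u 1) (u i) w < 0} \<le> 0" "2 \<le> i" "i \<le> 5"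
  shows "i < k \<Longrightarrow> k \<le> 6 \<Longrightarrow> 0 < orient (u 1) (u i) (u k)" "w \<in> V \<Longrightarrow> 0 < orient (u 1) (u i) w"
proof -
  have e: "\<not> orient (u 1) (u i) w < 0" if "w \<in> Q" "0 < orient p (u i) w" for w
    using assms(1) fin that by auto
  show "0 < orient (u 1) (u i) (u k)" if "i < k" "k \<le> 6"
    using e[of "u k"] uQ[of k] ang[of i k] nonzero[of 1 i k] assms(2) that by simp
  show "0 < orient (u 1) (u i) w" if "w \<in> V"
    using e[of w] V_Q V_ang[of w i] nonzero_V[of w 1 i] assms(2,3) that by simp
qed

lemma pos_12: "3 \<le> k \<Longrightarrow> k \<le> 6 \<Longrightarrow> 0 < orient (u 1) (u 2) (u k)"
  using pos_if_no_neg(1)[OF card_neg_le[of 2 0 1], of k] cov_bound_0 by simp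

lemma pos_13: "4 \<le> k \<Longrightarrow> k \<le> 6 \<Longrightarrow> 0 < orient (u 1) (u 3) (u k)"
proof (rule pos_if_no_neg(1)[OF card_neg_le[of 3 0 2]])
  show "0 < orient (u 1) (u j) (u 3)" if "1 < j" "j < 3" for j
    using that pos_12[of 3] by (cases "j = 2") simp_all
qed (use cov_bound_1 in \<open>simp_all add: One_nat_def\<close>)

text \<open>With \<open>j = 0\<close> the sector would have 2 points and cost 3 sets, in total 4
  sets for 6 points, and 44 > 42. With \<open>j = 1\<close> it has 3 points for the same 3 sets; so
  one exception has to be tolerated at \<open>u 4\<close>.\<close>

lemma card_neg_14_le: "card {w \<in> Q. 0 < orient p (u 4) w \<and> orient (u 1) (u 4) w < 0} \<le> 1"
proof (rule card_neg_le[of 4 1 3])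
  show "0 < orient (u 1) (u j) (u 4)" if "1 < j" "j < 4" for j
  proof -
    have "j = 2 \<or> j = 3" using that by linarith
    then show ?thesis using pos_12[of 4] pos_13[of 4] by auto
  qed
qed (use cov_bound_3 in simp_all)

lemma card_neg_15_le:
  assumes "0 < orient (u 1) (u 4) (u 5)"
  shows "card {w \<in> Q. 0 < orient p (u 5) w \<and> orient (u 1) (u 5) w < 0} \<le> 0"
proof (rule card_neg_le[of 5 0 3])
  show "0 < orient (u 1) (u j) (u 5)" if "1 < j" "j < 5" for j
  proof -
    have "j = 2 \<or> j = 3 \<or> j = 4" using that by linarith
    then show ?thesis using pos_12[of 5] pos_13[of 5] assms by auto
  qed
qed (use cov_bound_3 in simp_all)

lemma pos_145_or_146: "0 < orient (u 1) (u 4) (u 5) \<or> 0 < orient (u 1) (u 4) (u 6)"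
proof (rule ccontr)
  assume "\<not> ?thesis"
  then have "{u 5, u 6} \<subseteq> {w \<in> Q. 0 < orient p (u 4) w \<and> orient (u 1) (u 4) w < 0}"
    using nonzero[of 1 4 5] nonzero[of 1 4 6] ang[of 4 5] ang[of 4 6] uQ[of 5] uQ[of 6] by auto
  then have "card {u 5, u 6} \<le> card {w \<in> Q. 0 < orient p (u 4) w \<and> orient (u 1) (u 4) w < 0}"
    using fin by (intro card_mono) simp_all
  then show False using card_neg_14_le u_neq[of 5 6] by simp
qed

lemma pos_14_V:
  assumes "orient (u 1) (u 4) (u 5) < 0" "w \<in> V"
  shows "0 < orient (u 1) (u 4) w"
proof (rule ccontr)
  assume "\<not> ?thesis"
  then have "{u 5, w} \<subseteq> {w \<in> Q. 0 < orient p (u 4) w \<and> orient (u 1) (u 4) w < 0}"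
    using assms nonzero_V[of w 1 4] ang[of 4 5] V_ang[of w 4] uQ[of 5] V_Q[of w] by auto
  then have "card {u 5, w} \<le> card {w \<in> Q. 0 < orient p (u 4) w \<and> orient (u 1) (u 4) w < 0}"
    using fin by (intro card_mono) simp_all
  then show False using card_neg_14_le V_neq(2)[of w 5] assms(2) by simp
qed

lemma V_nonempty: "V \<noteq> {}"
  using card card_V by auto

lemma obtain_first_V:
  obtains q where "q \<in> V" "\<And>w. w \<in> V \<Longrightarrow> w \<noteq> q \<Longrightarrow> 0 < orient p q w"
proof -
  have "\<exists>q\<in>V. \<forall>w\<in>V - {q}. 0 < orient p q w"
  proof (rule ex_least_of_total)
    show "finite V" using fin unfolding V_def by simp
    show "0 < orient p a c" if "a \<in> V" "b \<in> V" "c \<in> V" "0 < orient p a b" "0 < orient p b c" for a b c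
      using that V_ang[of _ 1] by (intro orient_trans_halfplane[of p "u 1" a b c]) simp_all
    show "0 < orient p a b \<or> 0 < orient p b a" if "a \<in> V" "b \<in> V" "a \<noteq> b" for a b
    proof -
      have "orient p a b \<noteq> 0"
        using that V_Q pQ V_neq(1)[of a] V_neq(1)[of b] by (intro orient_nonzero[OF gp]) auto
      then show ?thesis using orient_swap[of p a b] by linarith
    qed
  qed (rule V_nonempty)
  then show thesis using that by blast
qed

text \<open>The sixth point is first or last in angular order, so the ray from \<open>p\<close>
  through it separates the other five from an empty piece of the half-plane. This is why only the
  first five and the last five are considered.\<close>

lemma five_convex:
  assumes S: "S = u ` {1..5} \<or> S = u ` {2..6}" and axyz: "{a, x, y, z} \<subseteq> S"
    and pos: "0 < orient a x y" "0 < orient a y z" "0 < orient a z x"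
  shows False
proof -
  obtain q where q: "q \<in> V" "\<And>w. w \<in> V \<Longrightarrow> w \<noteq> q \<Longrightarrow> 0 < orient p q w"
    using obtain_first_V by blast
  have SQ: "S \<subseteq> Q" using S uQ by auto
  have "card S \<le> 5" using S card_image_le[of "{1..5}" u] card_image_le[of "{2..6}" u] by auto
  then have five: "coverable UNIV S 4"
    using SQ axyz by (intro coverable_five[OF _ _ _ _ pos] in_general_position_subset[OF gp SQ])
      (auto intro: finite_subset[OF _ fin])
  have bq: "0 < orient p w q \<longleftrightarrow> w \<in> u ` {1..6}" if w: "w \<in> Q" for w
  proof (cases "w \<in> V")
    case True
    then have "\<not> 0 < orient p w q"
      using q(2)[of w] orient_swap[of p w q] by (cases "w = q") simp_all
    then show ?thesis using True unfolding V_def by simp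
  next
    case False
    then show ?thesis using w V_ang[OF q(1)] p_neq(1) unfolding V_def by force
  qed
  have "inj_on u {1..6}"
    by (rule linorder_inj_onI) (use u_neq in auto)
  then have "card (u ` {1..6}) = 6" using card_image by force
  moreover have "{w \<in> Q. 0 < orient p w q} = u ` {1..6}" using bq uQ by auto
  ultimately have n: "card {w \<in> Q. 0 < orient p w q} = 6" by simp
  have up: "orient p (u i) q > 0" if "1 \<le> i" "i \<le> 6" for i using V_ang[OF q(1)] that by simp
  have up': "{p, u i, q} \<subseteq> Q" if "1 \<le> i" "i \<le> 6" for i using that uQ pQ V_Q[OF q(1)] by simp
  have l: "cov_bound (card Q - (6 + 2)) (target (card Q - 8))" using IH_diff[of 8] by simp
  have empty: "coverable UNIV {} 1" by (rule coverable_convex) simp_all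
  have o: "orient p (u i) (u j) \<le> 0 \<longleftrightarrow> j \<le> i" if "1 \<le> i" "1 \<le> j" "i \<le> 6" "j \<le> 6" for i j
  proof (cases i j rule: linorder_cases)
    case less
    then show ?thesis using ang[of i j] that by simp
  next
    case greater
    then show ?thesis using ang[of j i] that orient_swap[of p "u j" "u i"] by simp
  qed simp
  have "coverable UNIV Q (5 + target (card Q - 8))"
    using S
  proof
    assume S: "S = u ` {1..5}"
    have "w \<in> S" if w: "w \<in> Q" "0 < orient p w q" "0 < orient p w (u 6)" for w
    proof -
      have "w \<in> u ` {1..6}" using bq w by blast
      then obtain i where i: "w = u i" "1 \<le> i" "i \<le> 6" by auto
      then have "i \<noteq> 6" using w by auto
      then show ?thesis using i S by auto
    qed
    moreover have "w \<in> Q \<and> 0 < orient p w q \<and> 0 < orient p w (u 6)" if "w \<in> S" for w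
      using that S SQ up ang[of _ 6] by auto
    ultimately have 1: "Q \<inter> {w. 0 < orient p w q \<and> 0 < orient p w (u 6)} = S" by blast
    have "\<not> (0 < orient p (u 6) w \<and> 0 < orient p w q)" if w: "w \<in> Q" for w
    proof
      assume a: "0 < orient p (u 6) w \<and> 0 < orient p w q"
      then have "w \<in> u ` {1..6}" using bq w by blast
      then obtain i where i: "w = u i" "1 \<le> i" "i \<le> 6" by auto
      then show False using a o[of 6 i] by simp
    qed
    then have 2: "Q \<inter> sector p (u 6) q = {}" unfolding sector_def by blast
    have "coverable UNIV Q (4 + 1 + target (card Q - 8))"
      by (rule coverable_fan_bound[OF fin gp up'[of 6] up[of 6] _ _ n l]) (use five empty in \<open>simp_all add: 1 2\<close>)
    then show ?thesis by simp
  next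
    assume S: "S = u ` {2..6}"
    have "w \<in> S" if w: "w \<in> Q" "0 < orient p (u 1) w" "0 < orient p w q" for w
    proof -
      have "w \<in> u ` {1..6}" using bq w by blast
      then obtain i where i: "w = u i" "1 \<le> i" "i \<le> 6" by auto
      then have "i \<noteq> 1" using w by auto
      then show ?thesis using i S by auto
    qed
    moreover have "w \<in> Q \<and> 0 < orient p (u 1) w \<and> 0 < orient p w q" if "w \<in> S" for w
      using that S SQ up ang[of 1] by auto
    ultimately have 1: "Q \<inter> sector p (u 1) q = S" unfolding sector_def by blast
    have "\<not> (0 < orient p w q \<and> 0 < orient p w (u 1))" if w: "w \<in> Q" for w
    proof
      assume a: "0 < orient p w q \<and> 0 < orient p w (u 1)"
      then have "w \<in> u ` {1..6}" using bq w by blast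
      then obtain i where i: "w = u i" "1 \<le> i" "i \<le> 6" by auto
      then show False using a o[of 1 i] orient_swap[of p "u 1" "u i"] by simp
    qed
    then have 2: "Q \<inter> {w. 0 < orient p w q \<and> 0 < orient p w (u 1)} = {}" by blast
    have "coverable UNIV Q (1 + 4 + target (card Q - 8))"
      by (rule coverable_fan_bound[OF fin gp up'[of 1] up[of 1] _ _ n l]) (use five empty in \<open>simp_all add: 1 2\<close>)
    then show ?thesis by simp
  qed
  then show False by (rule no_reduction[rotated 3]) (use card in simp_all)
qed

end

section \<open>Orientation signs of the first six points\<close>

context counterexample
begin

abbreviation "P i j k \<equiv> 0 < orient (u i) (u j) (u k)"

lemma quad:
  assumes "1 \<le> i" "i < j" "j < k" "k < l" "l \<le> 6"
  shows "(P i j k \<and> P j k l \<longrightarrow> P i j l \<and> P i k l) \<and> (\<not> P i j k \<and> \<not> P j k l \<longrightarrow> \<not> P i j l \<and> \<not> P i k l) \<and>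
    (P i j k \<and> P i k l \<longrightarrow> P i j l) \<and> (\<not> P i j k \<and> \<not> P i k l \<longrightarrow> \<not> P i j l) \<and>
    (P i j l \<and> P j k l \<longrightarrow> P i k l) \<and> (\<not> P i j l \<and> \<not> P j k l \<longrightarrow> \<not> P i k l)"
  by (rule quad_signs[where p = p]) (use assms in \<open>simp_all add: ang nonzero\<close>)

lemma quad_V:
  assumes "1 \<le> i" "i < j" "j < k" "k \<le> 6" "w \<in> V"
  shows "(P i j k \<and> 0 < orient (u j) (u k) w \<longrightarrow> 0 < orient (u i) (u j) w \<and> 0 < orient (u i) (u k) w) \<and>
    (\<not> P i j k \<and> \<not> 0 < orient (u j) (u k) w \<longrightarrow> \<not> 0 < orient (u i) (u j) w \<and> \<not> 0 < orient (u i) (u k) w) \<and>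
    (P i j k \<and> 0 < orient (u i) (u k) w \<longrightarrow> 0 < orient (u i) (u j) w) \<and>
    (\<not> P i j k \<and> \<not> 0 < orient (u i) (u k) w \<longrightarrow> \<not> 0 < orient (u i) (u j) w) \<and>
    (0 < orient (u i) (u j) w \<and> 0 < orient (u j) (u k) w \<longrightarrow> 0 < orient (u i) (u k) w) \<and>
    (\<not> 0 < orient (u i) (u j) w \<and> \<not> 0 < orient (u j) (u k) w \<longrightarrow> \<not> 0 < orient (u i) (u k) w)"
  by (rule quad_signs[where p = p]) (use assms in \<open>simp_all add: ang nonzero nonzero_V V_ang\<close>)

text \<open>If the only sign change is after the first or before the last triple, then
  \<open>u j\<close> or \<open>u k\<close> lies inside the triangle of the other three, against
  \<open>five_convex\<close>. Together with \<open>quad\<close> this leaves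
  \<open>P i j k = P i j l\<close> and \<open>P i k l = P j k l\<close>.\<close>

lemma convex_quad:
  assumes i: "1 \<le> i" "i < j" "j < k" "k < l" "l \<le> 6" and r: "l \<le> 5 \<or> 2 \<le> i"
  shows "\<not> (P i j k \<noteq> P i j l \<and> P i j l = P i k l \<and> P i k l = P j k l) \<and>
    \<not> (P j k l \<noteq> P i j k \<and> P i j k = P i j l \<and> P i j l = P i k l)"
proof -
  obtain S where S: "S = u ` {1..5} \<or> S = u ` {2..6}" "{u i, u j, u k, u l} \<subseteq> S"
  proof (cases "l \<le> 5")
    case True
    have "u ` {i, j, k, l} \<subseteq> u ` {1..5}" by (rule image_mono) (use i True in auto)
    then show thesis by (intro that[of "u ` {1..5}"]) simp_all
  next
    case False
    have "u ` {i, j, k, l} \<subseteq> u ` {2..6}" by (rule image_mono) (use i r False in auto)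
    then show thesis by (intro that[of "u ` {2..6}"]) simp_all
  qed
  note five = five_convex[OF S(1)]
  have ord: "j < l" "i < k" using i by linarith+
  note s = sort_u[OF i(2,3)] sort_u[OF i(2) ord(1)] sort_u[OF ord(2) i(4)] sort_u[OF i(3,4)]
  have neg: "orient (u i) (u j) (u k) < 0 \<longleftrightarrow> \<not> P i j k" "orient (u i) (u j) (u l) < 0 \<longleftrightarrow> \<not> P i j l"
    "orient (u i) (u k) (u l) < 0 \<longleftrightarrow> \<not> P i k l" "orient (u j) (u k) (u l) < 0 \<longleftrightarrow> \<not> P j k l"
    using nonzero[of i j k] nonzero[of i j l] nonzero[of i k l] nonzero[of j k l] i by linarith+
  have "\<not> (\<not> P i j k \<and> P i j l \<and> P i k l \<and> P j k l)"
    using five[of "u j" "u i" "u k" "u l"] S(2) by (simp add: s neg; blast)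
  moreover have "\<not> (P i j k \<and> \<not> P i j l \<and> \<not> P i k l \<and> \<not> P j k l)"
    using five[of "u j" "u i" "u l" "u k"] S(2) by (simp add: s neg; blast)
  moreover have "\<not> (P i j k \<and> P i j l \<and> P i k l \<and> \<not> P j k l)"
    using five[of "u k" "u i" "u j" "u l"] S(2) by (simp add: s neg; blast)
  moreover have "\<not> (\<not> P i j k \<and> \<not> P i j l \<and> \<not> P i k l \<and> P j k l)"
    using five[of "u k" "u j" "u i" "u l"] S(2) by (simp add: s neg; blast)
  ultimately show ?thesis by blast
qed

text \<open>One sign propagates through the four-point patterns. In 1, 3, 4, 5 the single change is
  used up at 1 4 5, so 3 4 5 is negative; in 1, 4, 5, 6 it is used up at 1 4 6, so 4 5 6 is
  positive.\<close>

lemma pattern_145_neg: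
  assumes "\<not> P 1 4 5"
  shows "P 1 4 6" "\<not> P 2 4 5" "\<not> P 2 4 6" "\<not> P 3 4 5" "P 4 5 6" "P 2 3 4"
proof -
  have b: "P 1 2 3" "P 1 2 4" "P 1 2 5" "P 1 2 6" "P 1 3 4" "P 1 3 5" "P 1 3 6"
    using pos_12 pos_13 by simp_all
  show e: "P 1 4 6" using pos_145_or_146 assms by blast
  have c: "\<not> P 3 4 5" using quad[of 1 3 4 5] b assms by simp
  then show "\<not> P 3 4 5" .
  have d: "P 4 5 6" using quad[of 1 4 5 6] e assms by simp
  then show "P 4 5 6" .
  note q = quad[of 2 3 4 6, simplified] quad[of 2 4 5 6, simplified] quad[of 3 4 5 6, simplified] quad[of 2 3 5 6, simplified]
    convex_quad[of 1 2 3 5, simplified] convex_quad[of 2 3 4 6, simplified] convex_quad[of 2 4 5 6, simplified] convex_quad[of 3 4 5 6, simplified] convex_quad[of 2 3 5 6, simplified]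
  show "\<not> P 2 4 5" "\<not> P 2 4 6" "P 2 3 4"
    using q b c d e assms by sat+
qed

text \<open>After this only the sign of 4 5 6 is open: once it is positive, all triples of the six
  points are.\<close>

lemma pattern_145:
  assumes "P 1 4 5" "P 1 5 6"
  shows "P 2 3 5" "P 2 3 4" "P 2 4 5" "P 3 4 5" "P 1 4 6"
    "P 2 5 6 = P 4 5 6" "P 3 5 6 = P 4 5 6" "P 4 5 6 \<Longrightarrow> P 2 3 6 \<and> P 2 4 6 \<and> P 3 4 6"
proof -
  have b: "P 1 2 3" "P 1 2 4" "P 1 2 5" "P 1 2 6" "P 1 3 4" "P 1 3 5" "P 1 3 6"
    using pos_12 pos_13 by simp_all
  have c: "P 2 3 5" using convex_quad[of 1 2 3 5] b by simp
  then show "P 2 3 5" .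
  have d: "P 3 4 5" using convex_quad[of 1 3 4 5] b assms by simp
  then show "P 3 4 5" .
  show "P 1 4 6" using quad[of 1 4 5 6] assms by simp
  note q = quad[of 2 3 4 6, simplified] quad[of 2 4 5 6, simplified] quad[of 3 4 5 6, simplified] quad[of 2 3 5 6, simplified]
    convex_quad[of 2 3 4 6, simplified] convex_quad[of 2 4 5 6, simplified] convex_quad[of 3 4 5 6, simplified] convex_quad[of 2 3 5 6, simplified]
  show "P 2 3 4" "P 2 4 5" "P 2 5 6 = P 4 5 6" "P 3 5 6 = P 4 5 6"
    "P 4 5 6 \<Longrightarrow> P 2 3 6 \<and> P 2 4 6 \<and> P 3 4 6"
    using q b c d assms by sat+
qed

section \<open>Triangles around \<open>u 4\<close> and \<open>u 5\<close>\<close>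

lemma no_cone:
  assumes "{a, x, y} \<subseteq> Q" "0 < orient a x y" "card (Q \<inter> sector a x y) = n"
    "card {w \<in> Q. 0 < orient a y w \<and> 0 < orient a x w} = r"
    "j < card {w \<in> Q. orient a x w < 0 \<and> 0 < orient a y w}"
    "cov_bound n i" "cov_bound (r + j) k" "4 + n + r + j \<le> card Q" "11 * (i + k) \<le> 7 * (4 + n + r + j)"
  shows False
proof (rule no_reduction)
  show "coverable UNIV Q (i + k + target (card Q - (4 + n + r + j)))"
    by (rule coverable_cone[OF fin gp assms(1-7) IH_diff]) simp
qed (use assms in simp_all)

lemma P_neg: "1 \<le> i \<Longrightarrow> i < j \<Longrightarrow> j < k \<Longrightarrow> k \<le> 6 \<Longrightarrow> \<not> P i j k \<Longrightarrow> orient (u i) (u j) (u k) < 0"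
  using nonzero[of i j k] by linarith

lemma V_neg: "w \<in> V \<Longrightarrow> 1 \<le> i \<Longrightarrow> i < j \<Longrightarrow> j \<le> 6 \<Longrightarrow> \<not> 0 < orient (u i) (u j) w \<Longrightarrow> orient (u i) (u j) w < 0"
  using nonzero_V[of w i j] by linarith

lemmas sorts = sort_u sort_p sort_p2

text \<open>Makes the counts computable: known signs settle the condition at the seven named points,
  and only the count over \<open>V\<close> stays symbolic.\<close>

lemma card_Collect_Q:
  fixes K :: "nat set"
  assumes "\<not> c p" "c (u 1) \<longleftrightarrow> 1 \<in> K" "c (u 2) \<longleftrightarrow> 2 \<in> K" "c (u 3) \<longleftrightarrow> 3 \<in> K"
    "c (u 4) \<longleftrightarrow> 4 \<in> K" "c (u 5) \<longleftrightarrow> 5 \<in> K" "c (u 6) \<longleftrightarrow> 6 \<in> K" "K \<subseteq> {1..6}"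
  shows "card {z \<in> Q. c z} = card K + card {z \<in> V. c z}"
proof -
  have K: "c (u k) \<longleftrightarrow> k \<in> K" if "1 \<le> k" "k \<le> 6" for k
  proof -
    have "k = 1 \<or> k = 2 \<or> k = 3 \<or> k = 4 \<or> k = 5 \<or> k = 6" using that by linarith
    then show ?thesis using assms(2-7) by blast
  qed
  have "{z \<in> Q. c z} = u ` K \<union> {z \<in> V. c z}"
  proof -
    have "z \<in> u ` K \<union> {z \<in> V. c z}" if z: "z \<in> Q" "c z" for z
    proof (cases "z \<in> V")
      case False
      moreover have "z \<noteq> p" using z(2) assms(1) by blast
      ultimately have "z \<in> u ` {1..6}" using z(1) unfolding V_def by blast
      then obtain k where "z = u k" "1 \<le> k" "k \<le> 6" by auto
      then show ?thesis using K z(2) by blast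
    qed (use z in simp)
    moreover have "u k \<in> Q \<and> c (u k)" if "k \<in> K" for k
    proof -
      have "1 \<le> k" "k \<le> 6" using that assms(8) by auto
      then show ?thesis using K that uQ by blast
    qed
    ultimately show ?thesis using V_Q by blast
  qed
  moreover have "u ` K \<inter> {z \<in> V. c z} = {}" using assms(8) unfolding V_def by blast
  moreover have "finite (u ` K)" "finite {z \<in> V. c z}"
    using assms(8) fin finite_subset unfolding V_def by auto
  moreover have "card (u ` K) = card K"
  proof (rule card_image)
    have "inj_on u {1..6}"
      by (rule linorder_inj_onI) (use u_neq in auto)
    then show "inj_on u K" using assms(8) by (rule inj_on_subset)
  qed
  ultimately show ?thesis by (simp add: card_Un_disjoint)
qed

lemma sector_Collect: "Q \<inter> sector a x y = {z \<in> Q. 0 < orient a x z \<and> 0 < orient a z y}"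
  unfolding sector_def by blast

text \<open>Otherwise \<open>u 5\<close> is the single exception at \<open>u 4\<close>, so
  \<open>V\<close> lies on the positive side of the line through \<open>u 1\<close> and
  \<open>u 4\<close>. Then a triangle around \<open>u 4\<close> over \<open>u 1\<close>,
  \<open>u 2\<close> gives a reduction, or else one over \<open>u 2\<close>, \<open>u 5\<close>
  does.\<close>

lemma pos_145: "P 1 4 5"
proof (rule ccontr)
  assume n: "\<not> P 1 4 5"
  note pat = pattern_145_neg[OF n]
  have b: "P 1 2 4" "P 1 3 4" using pos_12 pos_13 by simp_all
  have neg: "orient (u 1) (u 4) (u 5) < 0" "orient (u 2) (u 4) (u 5) < 0" "orient (u 2) (u 4) (u 6) < 0"
    "orient (u 3) (u 4) (u 5) < 0"
    using n pat by (auto intro!: P_neg)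
  note facts = pat(1,5,6) b neg[THEN order_less_not_sym] neg
    pat(1,5,6)[THEN order_less_not_sym] b[THEN order_less_not_sym]
  have a: "0 < orient p (u 1) (u 4)" "0 < orient p (u 2) (u 4)" "0 < orient p (u 3) (u 4)" "0 < orient p (u 4) (u 5)"
    by (simp_all add: ang)
  note facts = facts a a[THEN order_less_not_sym]
  have V14: "0 < orient (u 1) (u 4) w" if "w \<in> V" for w
    by (rule pos_14_V[OF neg(1) that])
  have V24: "0 < orient (u 2) (u 4) w" if w: "w \<in> V" for w
  proof (rule ccontr)
    assume n: "\<not> 0 < orient (u 2) (u 4) w"
    \<comment> \<open>The first sector is empty, \<open>u 3\<close> and \<open>u 5\<close> precede
      the candidates, and \<open>u 6\<close> and \<open>w\<close> are two candidates, which permits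
      \<open>j = 1\<close>: 7 points for 1 + 3 sets.\<close>
    show False
    proof (rule no_cone[where a = "u 4" and x = "u 1" and y = "u 2" and n = 0 and r = 2 and j = 1
        and i = 1 and k = 3])
      show "{u 4, u 1, u 2} \<subseteq> Q" using uQ by simp
      show "0 < orient (u 4) (u 1) (u 2)" using facts by (simp add: sorts)
      have V0: "{z \<in> V. 0 < orient (u 4) (u 1) z \<and> c z} = {}" for c
        using V14 orient_swap_left[of "u 4" "u 1"] by fastforce
      have "card (Q \<inter> sector (u 4) (u 1) (u 2)) = card ({} :: nat set) +
          card {z \<in> V. 0 < orient (u 4) (u 1) z \<and> 0 < orient (u 4) z (u 2)}"
        unfolding sector_Collect by (rule card_Collect_Q) (simp_all add: sorts facts)
      then show "card (Q \<inter> sector (u 4) (u 1) (u 2)) = 0" unfolding V0 by simp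
      have "card {z \<in> Q. 0 < orient (u 4) (u 1) z \<and> 0 < orient (u 4) (u 2) z} = card {3, 5 :: nat} +
          card {z \<in> V. 0 < orient (u 4) (u 1) z \<and> 0 < orient (u 4) (u 2) z}"
        by (rule card_Collect_Q) (simp_all add: sorts facts)
      then show "card {z \<in> Q. 0 < orient (u 4) (u 2) z \<and> 0 < orient (u 4) (u 1) z} = 2"
        unfolding V0 by (simp add: conj_commute)
      have "card {z \<in> Q. orient (u 4) (u 1) z < 0 \<and> 0 < orient (u 4) (u 2) z} = card {6 :: nat} +
          card {z \<in> V. orient (u 4) (u 1) z < 0 \<and> 0 < orient (u 4) (u 2) z}"
        by (rule card_Collect_Q) (simp_all add: sorts facts)
      moreover have "0 < card {z \<in> V. orient (u 4) (u 1) z < 0 \<and> 0 < orient (u 4) (u 2) z}"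
      proof -
        have "w \<in> {z \<in> V. orient (u 4) (u 1) z < 0 \<and> 0 < orient (u 4) (u 2) z}"
          using w V14[OF w] V_neg[OF w _ _ _ n] by (simp add: orient_swap_left[of "u 4"])
        then show ?thesis using fin unfolding V_def by (subst card_gt_0_iff) auto
      qed
      ultimately show "1 < card {z \<in> Q. orient (u 4) (u 1) z < 0 \<and> 0 < orient (u 4) (u 2) z}" by simp
    qed (use cov_bound_0 cov_bound_3 card in \<open>simp_all add: One_nat_def\<close>)
  qed
  have V45: "0 < orient (u 4) (u 5) w" if w: "w \<in> V" for w
    using quad_V[of 2 4 5 w] w V24[OF w] n pat by simp
  have V0: "{z \<in> V. 0 < orient (u 4) (u 2) z \<and> c z} = {}" for c
    using V24 orient_swap_left[of "u 4" "u 2"] by fastforce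
  \<comment> \<open>Now \<open>u 3\<close> is in the first sector, \<open>u 6\<close> precedes the
    candidates, and all of \<open>V\<close> are candidates, so \<open>j = 2\<close> fills the second
    sector up to three points: 8 points for 2 + 3 sets.\<close>
  show False
  proof (rule no_cone[where a = "u 4" and x = "u 2" and y = "u 5" and n = 1 and r = 1 and j = 2
        and i = 2 and k = 3])
    show "{u 4, u 2, u 5} \<subseteq> Q" using uQ by simp
    show "0 < orient (u 4) (u 2) (u 5)" using facts by (simp add: sorts)
    have "card (Q \<inter> sector (u 4) (u 2) (u 5)) = card {3 :: nat} +
        card {z \<in> V. 0 < orient (u 4) (u 2) z \<and> 0 < orient (u 4) z (u 5)}"
      unfolding sector_Collect by (rule card_Collect_Q) (simp_all add: sorts facts)
    then show "card (Q \<inter> sector (u 4) (u 2) (u 5)) = 1" unfolding V0 by simp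
    have "card {z \<in> Q. 0 < orient (u 4) (u 2) z \<and> 0 < orient (u 4) (u 5) z} = card {6 :: nat} +
        card {z \<in> V. 0 < orient (u 4) (u 2) z \<and> 0 < orient (u 4) (u 5) z}"
      by (rule card_Collect_Q) (simp_all add: sorts facts)
    then show "card {z \<in> Q. 0 < orient (u 4) (u 5) z \<and> 0 < orient (u 4) (u 2) z} = 1"
      unfolding V0 by (simp add: conj_commute)
    have "V \<subseteq> {z \<in> Q. orient (u 4) (u 2) z < 0 \<and> 0 < orient (u 4) (u 5) z}"
      using V24 V45 V_Q orient_swap_left[of "u 4" "u 2"] by fastforce
    then have "card V \<le> card {z \<in> Q. orient (u 4) (u 2) z < 0 \<and> 0 < orient (u 4) (u 5) z}"
      using fin by (intro card_mono) simp_all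
    then show "2 < card {z \<in> Q. orient (u 4) (u 2) z < 0 \<and> 0 < orient (u 4) (u 5) z}"
      using card card_V by linarith
  qed (use cov_bound_1 cov_bound_3 card in simp_all)
qed

lemma pos_156: "P 1 5 6"
  using pos_if_no_neg(1)[OF card_neg_15_le[OF pos_145], of 6] by simp

lemma pos_15_V: "w \<in> V \<Longrightarrow> 0 < orient (u 1) (u 5) w"
  using pos_if_no_neg(2)[OF card_neg_15_le[OF pos_145]] by simp

text \<open>Otherwise triangles around \<open>u 5\<close> are tried over \<open>u 1\<close>,
  \<open>u 2\<close>, then \<open>u 2\<close>, \<open>u 3\<close>, then \<open>u 3\<close>,
  \<open>u 6\<close>. Each failure puts more of \<open>V\<close> on the positive side of a line
  through \<open>u 5\<close>, until the last one succeeds.\<close>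

lemma pos_456: "P 4 5 6"
proof (rule ccontr)
  assume n: "\<not> P 4 5 6"
  note pat = pattern_145[OF pos_145 pos_156]
  have b: "P 1 2 5" "P 1 3 5" using pos_12 pos_13 by simp_all
  have neg: "orient (u 2) (u 5) (u 6) < 0" "orient (u 3) (u 5) (u 6) < 0" "orient (u 4) (u 5) (u 6) < 0"
    using n pat(6,7) by (auto intro!: P_neg)
  have a: "0 < orient p (u 1) (u 5)" "0 < orient p (u 2) (u 5)" "0 < orient p (u 3) (u 5)"
    "0 < orient p (u 4) (u 5)" "0 < orient p (u 5) (u 6)"
    by (simp_all add: ang)
  note pos = pos_145 pos_156 pat(1,3,4) b a
  note facts = pos pos[THEN order_less_not_sym] neg neg[THEN order_less_not_sym]
  have V25: "0 < orient (u 2) (u 5) w" if w: "w \<in> V" for w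
  proof (rule ccontr)
    assume n: "\<not> 0 < orient (u 2) (u 5) w"
    show False
    proof (rule no_cone[where a = "u 5" and x = "u 1" and y = "u 2" and n = 0 and r = 2 and j = 1
        and i = 1 and k = 3])
      show "{u 5, u 1, u 2} \<subseteq> Q" using uQ by simp
      show "0 < orient (u 5) (u 1) (u 2)" using facts by (simp add: sorts)
      have V0: "{z \<in> V. 0 < orient (u 5) (u 1) z \<and> c z} = {}" for c
        using pos_15_V orient_swap_left[of "u 5" "u 1"] by fastforce
      have "card (Q \<inter> sector (u 5) (u 1) (u 2)) = card ({} :: nat set) +
          card {z \<in> V. 0 < orient (u 5) (u 1) z \<and> 0 < orient (u 5) z (u 2)}"
        unfolding sector_Collect by (rule card_Collect_Q) (simp_all add: sorts facts)
      then show "card (Q \<inter> sector (u 5) (u 1) (u 2)) = 0" unfolding V0 by simp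
      have "card {z \<in> Q. 0 < orient (u 5) (u 1) z \<and> 0 < orient (u 5) (u 2) z} = card {3, 4 :: nat} +
          card {z \<in> V. 0 < orient (u 5) (u 1) z \<and> 0 < orient (u 5) (u 2) z}"
        by (rule card_Collect_Q) (simp_all add: sorts facts)
      then show "card {z \<in> Q. 0 < orient (u 5) (u 2) z \<and> 0 < orient (u 5) (u 1) z} = 2"
        unfolding V0 by (simp add: conj_commute)
      have "card {z \<in> Q. orient (u 5) (u 1) z < 0 \<and> 0 < orient (u 5) (u 2) z} = card {6 :: nat} +
          card {z \<in> V. orient (u 5) (u 1) z < 0 \<and> 0 < orient (u 5) (u 2) z}"
        by (rule card_Collect_Q) (simp_all add: sorts facts)
      moreover have "0 < card {z \<in> V. orient (u 5) (u 1) z < 0 \<and> 0 < orient (u 5) (u 2) z}"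
      proof -
        have "w \<in> {z \<in> V. orient (u 5) (u 1) z < 0 \<and> 0 < orient (u 5) (u 2) z}"
          using w pos_15_V[OF w] V_neg[OF w _ _ _ n] by (simp add: orient_swap_left[of "u 5"])
        then show ?thesis using fin unfolding V_def by (subst card_gt_0_iff) auto
      qed
      ultimately show "1 < card {z \<in> Q. orient (u 5) (u 1) z < 0 \<and> 0 < orient (u 5) (u 2) z}" by simp
    qed (use cov_bound_0 cov_bound_3 card in \<open>simp_all add: One_nat_def\<close>)
  qed
  have V56: "0 < orient (u 5) (u 6) w" if w: "w \<in> V" for w
    using quad_V[of 2 5 6 w] w V25[OF w] neg by simp
  \<comment> \<open>These are the points of \<open>V\<close> that serve as third vertex over
    \<open>u 2\<close>, \<open>u 3\<close>. Two of them permit \<open>j = 1\<close> there; if there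
    is at most one, it falls into the second sector of the last triangle.\<close>
  define V3 where "V3 = {w \<in> V. orient (u 3) (u 5) w < 0}"
  have V3: "finite V3" "V3 \<subseteq> V" using fin by (auto simp: V3_def V_def)
  have inv: "orient (u 5) (u i) w = - orient (u i) (u 5) w" for i w by (rule orient_swap_left)
  show False
  proof (cases "card V3 \<le> 1")
    case False
    show False
    proof (rule no_cone[where a = "u 5" and x = "u 2" and y = "u 3" and n = 0 and r = 2 and j = 1
        and i = 1 and k = 3])
      show "{u 5, u 2, u 3} \<subseteq> Q" using uQ by simp
      show "0 < orient (u 5) (u 2) (u 3)" using facts by (simp add: sorts)
      have V0: "{z \<in> V. 0 < orient (u 5) (u 2) z \<and> c z} = {}" for c
        using V25 inv[of 2] by fastforce
      have "card (Q \<inter> sector (u 5) (u 2) (u 3)) = card ({} :: nat set) +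
          card {z \<in> V. 0 < orient (u 5) (u 2) z \<and> 0 < orient (u 5) z (u 3)}"
        unfolding sector_Collect by (rule card_Collect_Q) (simp_all add: sorts facts)
      then show "card (Q \<inter> sector (u 5) (u 2) (u 3)) = 0" unfolding V0 by simp
      have "card {z \<in> Q. 0 < orient (u 5) (u 2) z \<and> 0 < orient (u 5) (u 3) z} = card {4, 6 :: nat} +
          card {z \<in> V. 0 < orient (u 5) (u 2) z \<and> 0 < orient (u 5) (u 3) z}"
        by (rule card_Collect_Q) (simp_all add: sorts facts)
      then show "card {z \<in> Q. 0 < orient (u 5) (u 3) z \<and> 0 < orient (u 5) (u 2) z} = 2"
        unfolding V0 by (simp add: conj_commute)
      have "V3 \<subseteq> {z \<in> Q. orient (u 5) (u 2) z < 0 \<and> 0 < orient (u 5) (u 3) z}"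
        using V25 V_Q inv[of 2] inv[of 3] unfolding V3_def by fastforce
      then have "card V3 \<le> card {z \<in> Q. orient (u 5) (u 2) z < 0 \<and> 0 < orient (u 5) (u 3) z}"
        using fin by (intro card_mono) simp_all
      then show "1 < card {z \<in> Q. orient (u 5) (u 2) z < 0 \<and> 0 < orient (u 5) (u 3) z}"
        using False by linarith
    qed (use cov_bound_0 cov_bound_3 card in \<open>simp_all add: One_nat_def\<close>)
  next
    case True
    \<comment> \<open>The choice of \<open>j\<close> fills the second sector up to three points. The
      candidates include \<open>V - V3\<close>, so exceeding \<open>3 - card V3\<close> takes four
      points in \<open>V\<close>; this is what the assumption of 11 points provides.\<close>
    show False
    proof (rule no_cone[where a = "u 5" and x = "u 3" and y = "u 6" and n = 1 and r = "card V3"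
          and j = "3 - card V3" and i = 2 and k = 3])
      show "{u 5, u 3, u 6} \<subseteq> Q" using uQ by simp
      show "0 < orient (u 5) (u 3) (u 6)" using facts by (simp add: sorts)
      have V0: "{z \<in> V. c z \<and> 0 < orient (u 5) z (u 6)} = {}" for c
        using V56 orient_swap[of "u 5" _ "u 6"] by fastforce
      have "card (Q \<inter> sector (u 5) (u 3) (u 6)) = card {4 :: nat} +
          card {z \<in> V. 0 < orient (u 5) (u 3) z \<and> 0 < orient (u 5) z (u 6)}"
        unfolding sector_Collect by (rule card_Collect_Q) (simp_all add: sorts facts)
      then show "card (Q \<inter> sector (u 5) (u 3) (u 6)) = 1" unfolding V0 by simp
      have "{z \<in> V. 0 < orient (u 5) (u 6) z \<and> 0 < orient (u 5) (u 3) z} = V3"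
        using V56 inv[of 3] unfolding V3_def by auto
      moreover have "card {z \<in> Q. 0 < orient (u 5) (u 6) z \<and> 0 < orient (u 5) (u 3) z} = card ({} :: nat set) +
          card {z \<in> V. 0 < orient (u 5) (u 6) z \<and> 0 < orient (u 5) (u 3) z}"
        by (rule card_Collect_Q) (simp_all add: sorts facts)
      ultimately show "card {z \<in> Q. 0 < orient (u 5) (u 6) z \<and> 0 < orient (u 5) (u 3) z} = card V3"
        by simp
      have "w \<in> {z \<in> Q. orient (u 5) (u 3) z < 0 \<and> 0 < orient (u 5) (u 6) z}" if w: "w \<in> V - V3" for w
      proof -
        have "0 < orient (u 3) (u 5) w"
          using w nonzero_V[of w 3 5] unfolding V3_def by fastforce
        then show ?thesis using w V56[of w] V_Q[of w] inv[of 3] by simp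
      qed
      then have "card (V - V3) \<le> card {z \<in> Q. orient (u 5) (u 3) z < 0 \<and> 0 < orient (u 5) (u 6) z}"
        using fin by (intro card_mono) auto
      moreover have "card (V - V3) = card V - card V3" by (rule card_Diff_subset[OF V3])
      ultimately show "3 - card V3 < card {z \<in> Q. orient (u 5) (u 3) z < 0 \<and> 0 < orient (u 5) (u 6) z}"
        using card card_V True by linarith
    qed (use cov_bound_1 cov_bound_3 card True in simp_all)
  qed
qed

lemma contradiction: False
proof -
  obtain q where q: "q \<in> V" "\<And>w. w \<in> V \<Longrightarrow> w \<noteq> q \<Longrightarrow> 0 < orient p q w"
    using obtain_first_V by blast
  note pat = pattern_145[OF pos_145 pos_156]
  have all: "P i j k" if ijk: "1 \<le> i" "i < j" "j < k" "k \<le> 6" for i j k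
  proof -
    have "i = 1 \<or> i = 2 \<or> i = 3 \<or> i = 4" "j = 2 \<or> j = 3 \<or> j = 4 \<or> j = 5"
      "k = 3 \<or> k = 4 \<or> k = 5 \<or> k = 6"
      using ijk by linarith+
    then show ?thesis
      using ijk(2,3)
      by (elim disjE)
        (simp_all add: pos_12 pos_13 pos_145 pos_156 pos_456 pat(1-5) pat(6,7)[THEN iffD2, OF pos_456]
          pat(8)[OF pos_456])
  qed
  \<comment> \<open>The first point of \<open>V\<close> becomes the seventh, so that all other
    points of \<open>V\<close> lie on the far side of the line through \<open>p\<close> and
    it.\<close>
  define v where "v = u(7 := q)"
  have v: "v 7 = q" "\<And>i. i \<le> 6 \<Longrightarrow> v i = u i" by (simp_all add: v_def)
  have im: "insert p (v ` {1..7}) = insert q (insert p (u ` {1..6}))"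
  proof -
    have "v ` {1..6} = u ` {1..6}" by (rule image_cong) (simp_all add: v)
    moreover have "{1..7} = insert 7 {1..6 :: nat}" by auto
    ultimately show ?thesis using v(1) by auto
  qed
  have "cap p v"
  proof
    show "0 < orient p (v i) (v j)" if "1 \<le> i" "i < j" "j \<le> 7" for i j
      using ang[of i j] V_ang[OF q(1), of i] that v by (cases "j = 7") simp_all
    show "0 < orient (v i) (v j) (v k)" if "1 \<le> i" "i < j" "j < k" "k \<le> 6" for i j k
      using all[of i j k] that v by simp
  qed
  then have "coverable UNIV Q (5 + target (card Q - 8))"
  proof (rule coverable_cap[OF _ gp fin])
    show "insert p (v ` {1..7}) \<subseteq> Q" unfolding im using pQ uQ V_Q[OF q(1)] by auto
    show "orient p w (v 7) < 0" if w: "w \<in> Q" "w \<notin> insert p (v ` {1..7})" for w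
    proof -
      have "w \<in> V" "w \<noteq> q" using w unfolding im V_def by blast+
      then show ?thesis using q(2)[of w] orient_swap[of p w q] v(1) by simp
    qed
  qed (rule IH_diff, simp)
  then show False by (rule no_reduction[rotated 3]) (use card in simp_all)
qed

end

section \<open>The upper bound\<close>

lemma cov_bound_target: "cov_bound n (target n)"
proof (induction n rule: less_induct)
  case (less n)
  \<comment> \<open>The target is at least \<open>n + 1\<close> up to 8, but only \<open>n\<close>
    at 9 and 10. There one set is saved by removing three points for two sets, down to 6 and 7
    points.\<close>
  consider "n \<le> 8" | "n = 9" | "n = 10" | "11 \<le> n" by linarith
  then show ?case
  proof cases
    case 1
    then show ?thesis
      by (intro cov_bound_mono[OF cov_bound_trivial order_refl]) (simp add: target_def)
  next
    case 2
    then show ?thesis using cov_bound_add3[OF cov_bound_trivial[of 6]] by (simp add: target_def)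
  next
    case 3
    then show ?thesis using cov_bound_add3[OF cov_bound_trivial[of 7]] by (simp add: target_def)
  next
    case 4
    show ?thesis
      unfolding cov_bound_def
    proof (intro allI impI, elim conjE)
      fix Q assume fin: "finite Q" and le: "card Q \<le> n" and gp: "in_general_position Q"
      show "coverable UNIV Q (target n)"
      proof (cases "card Q = n")
        case False
        then have "cov_bound (card Q) (target (card Q))" using le by (intro less) simp
        then have "coverable UNIV Q (target (card Q))" by (rule cov_boundD[OF _ fin order_refl gp])
        then show ?thesis
          by (rule coverable_mono) (use le in \<open>simp_all add: target_def div_le_mono\<close>)
      next
        case True
        have "6 < card Q" using True 4 by simp
        from ex_apex[OF fin gp this] obtain p and u :: "nat \<Rightarrow> real^2" where pu: "p \<in> Q"
          "\<forall>i\<in>{1..6}. u i \<in> Q" "\<forall>i j. 1 \<le> i \<and> i < j \<and> j \<le> 6 \<longrightarrow> 0 < orient p (u i) (u j)"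
          "\<forall>w\<in>Q - insert p (u ` {1..6}). \<forall>i\<in>{1..6}. 0 < orient p (u i) w"
          by blast
        show ?thesis
        proof (rule ccontr)
          assume n: "\<not> coverable UNIV Q (target n)"
          interpret counterexample Q p u
          proof
            show "11 \<le> card Q" using 4 True by simp
            show "cov_bound m (target m)" if "m < card Q" for m using less True that by simp
            show "\<not> coverable UNIV Q (target (card Q))" using n True by simp
          qed (use pu fin gp in auto)
          show False by (rule contradiction)
        qed
      qed
    qed
  qed
qed

lemma ex_convex_cover:
  assumes "finite P" "in_general_position P"
  obtains \<F> where "finite \<F>" "card \<F> \<le> target (card P)" "convex_cover_avoiding P \<F>"
proof -
  have "coverable UNIV P (target (card P))"
    by (rule cov_boundD[OF cov_bound_target assms(1) order_refl assms(2)])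
  then obtain \<F> where F: "finite \<F>" "card \<F> \<le> target (card P)"
      "\<forall>C\<in>\<F>. convex C \<and> C \<inter> P = {}" "UNIV - P \<subseteq> \<Union>\<F>"
    unfolding coverable_def by blast
  then have "convex_cover_avoiding P \<F>"
    unfolding convex_cover_avoiding_def by blast
  with F(1,2) show thesis by (rule that)
qed

section \<open>Point sets of every size in general position\<close>

lemma orient_zero_if_collinear:
  assumes "collinear {a, b, c}"
  shows "orient a b c = 0"
proof -
  obtain u where u: "\<And>x y. x \<in> {a, b, c} \<Longrightarrow> y \<in> {a, b, c} \<Longrightarrow> \<exists>t. x - y = t *\<^sub>R u"
    using assms unfolding collinear_def by blast
  obtain s t where st: "b - a = s *\<^sub>R u" "c - a = t *\<^sub>R u"
    using u[of b a] u[of c a] by auto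
  have "b$i - a$i = s * u$i" "c$i - a$i = t * u$i" for i
    using arg_cong[OF st(1), of "\<lambda>v. v$i"] arg_cong[OF st(2), of "\<lambda>v. v$i"] by simp_all
  then show ?thesis by (simp add: orient_def)
qed

lemma ex_in_general_position: "\<exists>P. finite P \<and> card P = n \<and> in_general_position P"
proof -
  define f :: "nat \<Rightarrow> real^2" where "f i = vector [real i, (real i)\<^sup>2]" for i
  have f: "f i $ 1 = real i" "f i $ 2 = (real i)\<^sup>2" for i
    by (simp_all add: f_def)
  have "inj f"
    by (rule injI) (metis f(1) of_nat_eq_iff)
  moreover have "in_general_position (f ` {..<n})"
    unfolding in_general_position_def
  proof (clarsimp)
    fix i j k assume "f i \<noteq> f j" "f i \<noteq> f k" "f j \<noteq> f k" and col: "collinear {f i, f j, f k}"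
    then have "i \<noteq> j" "i \<noteq> k" "j \<noteq> k" by auto
    \<comment> \<open>The Vandermonde determinant of \<open>i\<close>, \<open>j\<close>,
      \<open>k\<close>.\<close>
    moreover have "orient (f i) (f j) (f k) = (real j - real i) * (real k - real i) * (real k - real j)"
      unfolding orient_def f by algebra
    ultimately show False using orient_zero_if_collinear[OF col] by simp
  qed
  ultimately show ?thesis
    by (intro exI[of _ "f ` {..<n}"]) (simp add: card_image inj_on_subset)
qed

lemma target_le: "real (target n) \<le> 7 * real n / 11 + 4"
proof -
  have "11 * target n \<le> 7 * n + 44" by (simp add: target_def)
  then have "11 * real (target n) \<le> 7 * real n + 44" by linarith
  then show ?thesis by simp
qed

theorem theorem4:
  fixes n :: nat
  shows "(\<forall>P :: (real^2) set. finite P \<and> card P = n \<and> in_general_position P \<longrightarrow>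
            (\<exists>\<F>. finite \<F> \<and> real (card \<F>) \<le> 7 * real n / 11 + 4 \<and> convex_cover_avoiding P \<F>))
         \<and> real (cov n) \<le> 7 * real n / 11 + 4"
proof (intro conjI allI impI, elim conjE)
  fix P :: "(real^2) set" assume P: "finite P" "card P = n" "in_general_position P"
  obtain \<F> where F: "finite \<F>" "card \<F> \<le> target (card P)" "convex_cover_avoiding P \<F>"
    using ex_convex_cover[OF P(1,3)] by blast
  have "real (card \<F>) \<le> 7 * real n / 11 + 4"
    using F(2) target_le[of n] unfolding P(2) by linarith
  with F(1,3) show "\<exists>\<F>. finite \<F> \<and> real (card \<F>) \<le> 7 * real n / 11 + 4 \<and> convex_cover_avoiding P \<F>"
    by blast
next
  let ?N = "{cov_number P | P. finite P \<and> card P = n \<and> in_general_position P}"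
  have le: "cov_number P \<le> target n" if P: "finite P" "card P = n" "in_general_position P" for P
  proof -
    obtain \<F> where F: "finite \<F>" "card \<F> \<le> target (card P)" "convex_cover_avoiding P \<F>"
      using ex_convex_cover[OF P(1,3)] by blast
    have "cov_number P \<le> card \<F>"
      unfolding cov_number_def by (rule Least_le) (use F in blast)
    then show ?thesis using F(2) P(2) by simp
  qed
  have N: "?N \<subseteq> {..target n}" using le by auto
  \<comment> \<open>Being nonempty and bounded, the set contains its \<open>Max\<close>, so the
    bound for single point sets applies to it.\<close>
  have "?N \<noteq> {}" using ex_in_general_position[of n] by blast
  then have "Max ?N \<in> ?N" by (rule Max_in[OF finite_subset[OF N finite_atMost]])
  then have "cov n \<le> target n" using N unfolding cov_def by blast
  then show "real (cov n) \<le> 7 * real n / 11 + 4"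
    using target_le[of n] by linarith
qed

end
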